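(* Let $a,b,c\in\mathbb{R}$ and consider the planar polynomial system $$\dot x=-y+a\,x^4y,\qquad \dot y = x+b\,x^3y^2+c\,x^5 .$$ This system has an isochronous center at the origin if and only if it reduces to one of the following two systems: $$\dot x=-y+a\,x^4y,\quad \dot y=x+5a\,x^3y^2-\tfrac45 a\,x^5 \qquad(\text{i.e. } b=5a,\ c=-\tfrac45 a),$$ or $$\dot x=-y+a\,x^4y,\quad \dot y=x+a\,x^3y^2\qquad(\text{i.e. } b=a,\ c=0).$$
   Context: An isolated singular point $p$ of a planar system is a center if there is a punctured neighborhood of $p$ in which every orbit is a cycle (a non-constant periodic orbit) surrounding $p$. The period annulus of a center $p$ is the largest connected neighborhood of $p$ covered by cycles surrounding $p$; the period function assigns to each point of the period annulus other than $p$ the minimal period of the cycle through it. The center is isochronous if the period function is constant on the period annulus. All parameters are real. *)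

theory Defs
  imports "HOL-Analysis.Analysis"
begin

definition solution_on :: "('a::real_normed_vector \<Rightarrow> 'a) \<Rightarrow> real set \<Rightarrow> (real \<Rightarrow> 'a) \<Rightarrow> bool" where
  "solution_on X I \<gamma> \<longleftrightarrow> (\<forall>t\<in>I. (\<gamma> has_vector_derivative X (\<gamma> t)) (at t))"

text \<open>For a locally Lipschitz field, the points reached by solutions on open intervals around 0
  that start in \<open>q\<close> are exactly the image of the maximal solution through \<open>q\<close>.\<close>

definition orbit :: "('a::real_normed_vector \<Rightarrow> 'a) \<Rightarrow> 'a \<Rightarrow> 'a set" where
  "orbit X q = {\<gamma> s | \<gamma> s. \<exists>I. open I \<and> is_interval I \<and> 0 \<in> I \<and> s \<in> I
                              \<and> solution_on X I \<gamma> \<and> \<gamma> 0 = q}"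

definition periodic_with :: "real \<Rightarrow> (real \<Rightarrow> 'a) \<Rightarrow> bool" where
  "periodic_with T \<gamma> \<longleftrightarrow> T > 0 \<and> (\<forall>t. \<gamma> (t + T) = \<gamma> t)"

definition is_cycle :: "('a::real_normed_vector \<Rightarrow> 'a) \<Rightarrow> 'a set \<Rightarrow> bool" where
  "is_cycle X C \<longleftrightarrow>
     (\<exists>\<gamma> T. solution_on X UNIV \<gamma> \<and> periodic_with T \<gamma> \<and> \<not> \<gamma> constant_on UNIV \<and> C = range \<gamma>)"

text \<open>The curve \<open>C\<close> surrounds \<open>p\<close> if \<open>p\<close> lies in a bounded component of its complement.\<close>

definition cycle_around :: "(real \<times> real \<Rightarrow> real \<times> real) \<Rightarrow> real \<times> real \<Rightarrow> (real \<times> real) set \<Rightarrow> bool" where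
  "cycle_around X p C \<longleftrightarrow> is_cycle X C \<and> p \<in> inside C"

definition isolated_singular_point :: "(real \<times> real \<Rightarrow> real \<times> real) \<Rightarrow> real \<times> real \<Rightarrow> bool" where
  "isolated_singular_point X p \<longleftrightarrow> X p = 0 \<and> (\<forall>\<^sub>F q in at p. X q \<noteq> 0)"

definition is_center :: "(real \<times> real \<Rightarrow> real \<times> real) \<Rightarrow> real \<times> real \<Rightarrow> bool" where
  "is_center X p \<longleftrightarrow>
     isolated_singular_point X p \<and> (\<forall>\<^sub>F q in at p. cycle_around X p (orbit X q))"

definition cycle_covered_nbhd :: "(real \<times> real \<Rightarrow> real \<times> real) \<Rightarrow> real \<times> real \<Rightarrow> (real \<times> real) set \<Rightarrow> bool" where
  "cycle_covered_nbhd X p U \<longleftrightarrow>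
     connected U \<and> p \<in> interior U \<and> (\<forall>q\<in>U - {p}. cycle_around X p (orbit X q))"

definition period_annulus :: "(real \<times> real \<Rightarrow> real \<times> real) \<Rightarrow> real \<times> real \<Rightarrow> (real \<times> real) set" where
  "period_annulus X p = \<Union>{U. cycle_covered_nbhd X p U}"

text \<open>At a center, this union is the greatest set of the family.\<close>

lemma period_annulus_greatest:
  assumes "is_center X p"
  shows "cycle_covered_nbhd X p (period_annulus X p)"
    and "cycle_covered_nbhd X p U \<Longrightarrow> U \<subseteq> period_annulus X p"
proof -
  obtain e where e: "e > 0" "\<forall>q. q \<noteq> p \<and> dist q p < e \<longrightarrow> cycle_around X p (orbit X q)"
    using assms by (auto simp: is_center_def eventually_at)
  have b: "cycle_covered_nbhd X p (ball p e)"
    unfolding cycle_covered_nbhd_def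
  proof (intro conjI ballI)
    show "cycle_around X p (orbit X q)" if "q \<in> ball p e - {p}" for q
      using e(2)[rule_format, of q] that by (simp add: dist_commute del: split_paired_All)
  qed (use e(1) in auto)
  show sub: "U \<subseteq> period_annulus X p" if "cycle_covered_nbhd X p U" for U
    using that by (auto simp: period_annulus_def)
  have "connected (period_annulus X p)"
    unfolding period_annulus_def
  proof (rule connected_Union)
    show "connected U" if "U \<in> {U. cycle_covered_nbhd X p U}" for U
      using that by (simp add: cycle_covered_nbhd_def)
    have "p \<in> \<Inter>{U. cycle_covered_nbhd X p U}"
      using interior_subset by (fastforce simp: cycle_covered_nbhd_def)
    then show "\<Inter>{U. cycle_covered_nbhd X p U} \<noteq> {}" by blast
  qed
  moreover have "p \<in> interior (period_annulus X p)"
    using b sub interior_mono unfolding cycle_covered_nbhd_def by blast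
  moreover have "\<forall>q\<in>period_annulus X p - {p}. cycle_around X p (orbit X q)"
    by (auto simp: period_annulus_def cycle_covered_nbhd_def)
  ultimately show "cycle_covered_nbhd X p (period_annulus X p)"
    by (simp add: cycle_covered_nbhd_def)
qed

text \<open>Meaningful only for \<open>q\<close> on a cycle: a non-constant continuous periodic function has a least
  positive period.\<close>

definition period_function :: "('a::real_normed_vector \<Rightarrow> 'a) \<Rightarrow> 'a \<Rightarrow> real" where
  "period_function X q = (LEAST T. \<exists>\<gamma>. solution_on X UNIV \<gamma> \<and> \<gamma> 0 = q \<and> periodic_with T \<gamma>)"

definition isochronous_center :: "(real \<times> real \<Rightarrow> real \<times> real) \<Rightarrow> real \<times> real \<Rightarrow> bool" where
  "isochronous_center X p \<longleftrightarrow>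
     is_center X p \<and> (\<exists>T. \<forall>q\<in>period_annulus X p - {p}. period_function X q = T)"

definition quintic_field :: "real \<Rightarrow> real \<Rightarrow> real \<Rightarrow> real \<times> real \<Rightarrow> real \<times> real" where
  "quintic_field a b c = (\<lambda>(x, y). (- y + a * x^4 * y, x + b * x^3 * y^2 + c * x^5))"

end

theory Submission
  imports Defs
begin

text \<open>Write \<open>P = x + c x^5\<close> and \<open>h = 1 + (5c - a + b) x^4 + c (b - 5a) x^8\<close>. Then
  \<open>P y' - y P' = P^2 + h y^2\<close>, so \<open>(P, y)\<close> turns about the origin with angular speed
  \<open>1 + (h - 1) y^2 / (P^2 + y^2)\<close>, and the two families of the theorem are exactly the solutions
  of \<open>h = 1\<close>. If \<open>h \<noteq> 1\<close>, then \<open>h - 1\<close> has constant sign for small \<open>x \<noteq> 0\<close>, and \<open>T\<close>-periodic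
  orbits close to the origin would give multiples of \<open>2 pi\<close> that are arbitrarily close to \<open>T\<close>
  but different from \<open>T\<close>. If \<open>h = 1\<close>, then multiplying \<open>(P, y)\<close> by a suitable power of
  \<open>1 - a x^4\<close> linearizes the system on the strip \<open>1 - a x^4 > 0\<close>, which contains every cycle
  around the origin.\<close>

section \<open>Uniqueness and least periods\<close>

text \<open>The linearizing coordinates are forced. For \<open>v = m(x) y\<close>, the equation
  \<open>v' = u\<close> with \<open>u\<close> a function of \<open>x\<close> alone requires the
  \<open>y^2\<close> terms to cancel; this says \<open>dm/dx = m b x^3 / (1 - a x^4)\<close> and
  leaves \<open>u = m P\<close>. The remaining equation \<open>u' = - v\<close> then reads
  \<open>h = 1\<close>. Since \<open>m > 0\<close>, the pair \<open>(P, y)\<close> has the same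
  polar angle as \<open>(u, v)\<close>; being polynomial, it involves no division by
  \<open>a\<close> or by \<open>1 - a x^4\<close>, and it still makes sense when \<open>h\<close> is
  not 1. In the necessity part the common period \<open>T\<close> is an unknown real: neither the
  number of turns per period nor a limit of periods is computed. All that enters is that the angle
  gained over a period is an integral multiple of \<open>2 pi\<close>, and that these multiples are
  discrete. The two directions use the annulus unequally. Necessity looks only at orbits through
  points \<open>(r, 0)\<close> with small \<open>r > 0\<close>, whereas sufficiency must settle the
  period on an annulus whose extent is never computed. Uniqueness comes first because
  \<open>orbit\<close> collects all local solutions.\<close>

lemma gronwall_zero:
  fixes d d' K :: "real \<Rightarrow> real"
  assumes I: "is_interval I" "t0 \<in> I" "t \<in> I"
    and d: "\<And>s. s \<in> I \<Longrightarrow> (d has_real_derivative d' s) (at s)"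
    and bound: "\<And>s. s \<in> I \<Longrightarrow> \<bar>d' s\<bar> \<le> K s * d s"
    and K: "continuous_on I K"
    and nonneg: "\<And>s. s \<in> I \<Longrightarrow> d s \<ge> 0"
    and zero: "d t0 = 0"
  shows "d t = 0"
proof -
  \<comment> \<open>Only the compact segment between \<open>t0\<close> and \<open>t\<close> matters.
    There \<open>K\<close> has a constant bound \<open>B\<close>, so \<open>exp (- (B * s))\<close>
    and \<open>exp (B * s)\<close> serve as integrating factors forwards and backwards in
    time.\<close>
  define J where "J = closed_segment t0 t"
  have J: "J \<subseteq> I" unfolding J_def
    using I by (meson closed_segment_subset is_interval_convex)
  have "compact (K ` J)"
    using K J by (intro compact_continuous_image) (auto simp: J_def intro: continuous_on_subset)
  then obtain B where B: "\<And>s. s \<in> J \<Longrightarrow> K s \<le> B"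
    by (metis bdd_above.E bounded_imp_bdd_above compact_imp_bounded imageI)
  have bound': "\<bar>d' s\<bar> \<le> B * d s" if "s \<in> J" for s
    using bound[of s] B[OF that] nonneg[of s] J that by (meson order_trans mult_right_mono subsetD)
  show ?thesis
  proof (cases "t0 \<le> t")
    case True
    have "d t * exp (- (B * t)) \<le> d t0 * exp (- (B * t0))"
    proof (rule DERIV_nonpos_imp_nonincreasing[OF True, of "\<lambda>s. d s * exp (- (B * s))"])
      fix s assume s: "t0 \<le> s" "s \<le> t"
      then have sJ: "s \<in> J" by (auto simp: J_def closed_segment_eq_real_ivl)
      have "((\<lambda>s. d s * exp (- (B * s))) has_real_derivative (d' s - B * d s) * exp (- (B * s))) (at s)"
        using sJ J by (auto intro!: derivative_eq_intros d simp: algebra_simps)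
      moreover have "(d' s - B * d s) * exp (- (B * s)) \<le> 0"
        using bound'[OF sJ] by (intro mult_nonpos_nonneg) auto
      ultimately show "\<exists>y. ((\<lambda>s. d s * exp (- (B * s))) has_real_derivative y) (at s) \<and> y \<le> 0" by blast
    qed
    then show ?thesis using zero nonneg[OF I(3)] by (simp add: mult_le_0_iff)
  next
    case False
    have "d t * exp (B * t) \<le> d t0 * exp (B * t0)"
    proof (rule DERIV_nonneg_imp_nondecreasing[of t t0 "\<lambda>s. d s * exp (B * s)"])
      fix s assume s: "t \<le> s" "s \<le> t0"
      then have sJ: "s \<in> J" by (auto simp: J_def closed_segment_eq_real_ivl)
      have "((\<lambda>s. d s * exp (B * s)) has_real_derivative (d' s + B * d s) * exp (B * s)) (at s)"
        using sJ J by (auto intro!: derivative_eq_intros d simp: algebra_simps)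
      moreover have "(d' s + B * d s) * exp (B * s) \<ge> 0"
        using bound'[OF sJ] by (intro mult_nonneg_nonneg) auto
      ultimately show "\<exists>y. ((\<lambda>s. d s * exp (B * s)) has_real_derivative y) (at s) \<and> y \<ge> 0" by blast
    qed (use False in auto)
    then show ?thesis using zero nonneg[OF I(3)] by (simp add: mult_le_0_iff)
  qed
qed

lemma linear_ode_zero:
  fixes w k :: "real \<Rightarrow> real"
  assumes "is_interval I" "t0 \<in> I" "t \<in> I"
    and w: "\<And>s. s \<in> I \<Longrightarrow> (w has_real_derivative k s * w s) (at s)"
    and k: "continuous_on I k"
    and "w t0 = 0"
  shows "w t = 0"
proof -
  have "(w t)\<^sup>2 = 0"
  proof (rule gronwall_zero[OF assms(1-3), of "\<lambda>s. (w s)\<^sup>2" "\<lambda>s. 2 * k s * (w s)\<^sup>2" "\<lambda>s. 2 * \<bar>k s\<bar>"])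
    show "((\<lambda>s. (w s)\<^sup>2) has_real_derivative 2 * k s * (w s)\<^sup>2) (at s)" if "s \<in> I" for s
      using w[OF that] by (auto intro!: derivative_eq_intros simp: power2_eq_square)
  qed (use assms in \<open>auto intro!: continuous_intros simp: abs_mult\<close>)
  then show ?thesis by simp
qed

text \<open>A change of sign would produce a zero by connectedness, and a zero propagates back to
  \<open>t0\<close> by uniqueness.\<close>

lemma linear_ode_pos:
  fixes w k :: "real \<Rightarrow> real"
  assumes I: "is_interval I" "t0 \<in> I" "t \<in> I"
    and w: "\<And>s. s \<in> I \<Longrightarrow> (w has_real_derivative k s * w s) (at s)"
    and k: "continuous_on I k"
    and pos: "w t0 > 0"
  shows "w t > 0"
proof (rule ccontr)
  assume "\<not> w t > 0"
  have "continuous_on I w"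
    using w by (meson DERIV_isCont continuous_at_imp_continuous_on)
  then have "is_interval (w ` I)"
    using I(1) by (simp add: connected_continuous_image is_interval_connected_1)
  then have "0 \<in> w ` I"
    using \<open>\<not> w t > 0\<close> pos I by (meson imageI is_interval_1 less_imp_le not_less)
  then obtain s where "s \<in> I" "w s = 0" by auto
  then have "w t0 = 0" using linear_ode_zero[OF I(1) _ I(2) w k] by blast
  with pos show False by simp
qed

lemma solution_on_quintic_iff:
  "solution_on (quintic_field a b c) I \<gamma> \<longleftrightarrow>
     (\<forall>t\<in>I. ((\<lambda>t. fst (\<gamma> t)) has_real_derivative
               - snd (\<gamma> t) + a * fst (\<gamma> t) ^ 4 * snd (\<gamma> t)) (at t)
         \<and> ((\<lambda>t. snd (\<gamma> t)) has_real_derivative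
               fst (\<gamma> t) + b * fst (\<gamma> t) ^ 3 * (snd (\<gamma> t))\<^sup>2 + c * fst (\<gamma> t) ^ 5) (at t))"
  (is "_ \<longleftrightarrow> (\<forall>t\<in>I. ?dx t \<and> ?dy t)")
proof -
  have "(\<gamma> has_vector_derivative quintic_field a b c (\<gamma> t)) (at t) \<longleftrightarrow> ?dx t \<and> ?dy t" for t
  proof
    assume "(\<gamma> has_vector_derivative quintic_field a b c (\<gamma> t)) (at t)"
    then show "?dx t \<and> ?dy t"
      using bounded_linear.has_vector_derivative[OF bounded_linear_fst, of \<gamma> _ "at t"]
        bounded_linear.has_vector_derivative[OF bounded_linear_snd, of \<gamma> _ "at t"]
      by (fastforce simp: quintic_field_def has_real_derivative_iff_has_vector_derivative split: prod.splits)
  next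
    assume "?dx t \<and> ?dy t"
    then have "((\<lambda>t. (fst (\<gamma> t), snd (\<gamma> t))) has_vector_derivative quintic_field a b c (\<gamma> t)) (at t)"
      unfolding has_real_derivative_iff_has_vector_derivative quintic_field_def case_prod_beta
      by (intro has_vector_derivative_Pair) auto
    then show "(\<gamma> has_vector_derivative quintic_field a b c (\<gamma> t)) (at t)" by simp
  qed
  then show ?thesis by (simp add: solution_on_def)
qed

lemma solution_on_continuous:
  "solution_on X I \<gamma> \<Longrightarrow> continuous_on I \<gamma>"
  by (meson solution_on_def continuous_at_imp_continuous_on has_vector_derivative_continuous)

lemma range_shift: "range (\<lambda>t. f (t + s)) = range f" for s :: real
  by (auto simp: image_iff) (metis diff_add_cancel)

lemma solution_on_shift:
  assumes "solution_on X UNIV \<gamma>"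
  shows "solution_on X UNIV (\<lambda>t. \<gamma> (t + s))"
  unfolding solution_on_def
proof
  fix t
  have "(\<gamma> has_vector_derivative X (\<gamma> (t + s))) (at (t + s))"
    using assms by (simp add: solution_on_def)
  then have "((\<gamma> \<circ> (\<lambda>t. t + s)) has_vector_derivative 1 *\<^sub>R X (\<gamma> (t + s))) (at t)"
    by (intro vector_diff_chain_at) (auto intro!: derivative_eq_intros)
  then show "((\<lambda>t. \<gamma> (t + s)) has_vector_derivative X (\<gamma> (t + s))) (at t)"
    by (simp add: o_def)
qed

text \<open>The left side is the derivative of \<open>p^2 + q^2\<close> along a planar linear
  system, so this is the hypothesis that \<open>gronwall_zero\<close> asks for.\<close>

lemma quadratic_form_bound:
  fixes p q A B C E :: real
  shows "\<bar>2 * (p * (A * p + B * q) + q * (C * p + E * q))\<bar>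
    \<le> 2 * (\<bar>A\<bar> + \<bar>B\<bar> + \<bar>C\<bar> + \<bar>E\<bar>) * (p\<^sup>2 + q\<^sup>2)"
proof -
  define D where "D = p\<^sup>2 + q\<^sup>2"
  have "2 * (\<bar>p\<bar> * \<bar>q\<bar>) \<le> D" "0 \<le> \<bar>p\<bar> * \<bar>q\<bar>"
    using sum_squares_bound[of "\<bar>p\<bar>" "\<bar>q\<bar>"] by (auto simp: D_def)
  then have pq: "\<bar>p\<bar> * \<bar>q\<bar> \<le> D" by linarith
  have sq: "p\<^sup>2 \<le> D" "q\<^sup>2 \<le> D" by (simp_all add: D_def)
  define u v w z where uvwz: "u = A * p\<^sup>2" "v = B * (p * q)" "w = C * (p * q)" "z = E * q\<^sup>2"
  have "\<bar>u\<bar> \<le> \<bar>A\<bar> * D" "\<bar>v\<bar> \<le> \<bar>B\<bar> * D" "\<bar>w\<bar> \<le> \<bar>C\<bar> * D" "\<bar>z\<bar> \<le> \<bar>E\<bar> * D"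
    unfolding uvwz abs_mult by (intro mult_left_mono; simp add: pq sq)+
  then have "2 * \<bar>u + v + w + z\<bar> \<le> 2 * (\<bar>A\<bar> * D + \<bar>B\<bar> * D + \<bar>C\<bar> * D + \<bar>E\<bar> * D)"
    by (smt (verit))
  moreover have "2 * (p * (A * p + B * q) + q * (C * p + E * q)) = 2 * (u + v + w + z)"
    unfolding uvwz by algebra
  ultimately have "\<bar>2 * (p * (A * p + B * q) + q * (C * p + E * q))\<bar>
      \<le> 2 * (\<bar>A\<bar> * D + \<bar>B\<bar> * D + \<bar>C\<bar> * D + \<bar>E\<bar> * D)"
    by (simp only: abs_mult) simp
  also have "\<dots> = 2 * (\<bar>A\<bar> + \<bar>B\<bar> + \<bar>C\<bar> + \<bar>E\<bar>) * D" by (simp add: algebra_simps)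
  finally show ?thesis unfolding D_def .
qed

text \<open>The difference of two solutions solves a linear equation whose coefficients are the
  divided differences of the field.\<close>

lemma quintic_solution_unique:
  assumes I: "is_interval I" "t0 \<in> I" "t \<in> I"
    and sol: "solution_on (quintic_field a b c) I \<gamma>" "solution_on (quintic_field a b c) I \<delta>"
    and eq: "\<gamma> t0 = \<delta> t0"
  shows "\<gamma> t = \<delta> t"
proof -
  define x1 y1 x2 y2 where xy: "x1 = (\<lambda>t. fst (\<gamma> t))" "y1 = (\<lambda>t. snd (\<gamma> t))"
    "x2 = (\<lambda>t. fst (\<delta> t))" "y2 = (\<lambda>t. snd (\<delta> t))"
  have dx1: "(x1 has_real_derivative - y1 s + a * x1 s ^ 4 * y1 s) (at s)"
    and dy1: "(y1 has_real_derivative x1 s + b * x1 s ^ 3 * (y1 s)\<^sup>2 + c * x1 s ^ 5) (at s)"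
    and dx2: "(x2 has_real_derivative - y2 s + a * x2 s ^ 4 * y2 s) (at s)"
    and dy2: "(y2 has_real_derivative x2 s + b * x2 s ^ 3 * (y2 s)\<^sup>2 + c * x2 s ^ 5) (at s)"
    if "s \<in> I" for s
    using sol that unfolding solution_on_quintic_iff xy by auto
  have cont: "continuous_on I x1" "continuous_on I y1" "continuous_on I x2" "continuous_on I y2"
    using sol[THEN solution_on_continuous] by (auto simp: xy intro!: continuous_intros)
  define A11 A12 A21 A22 where A:
    "A11 = (\<lambda>s. a * y2 s * (x1 s + x2 s) * ((x1 s)\<^sup>2 + (x2 s)\<^sup>2))"
    "A12 = (\<lambda>s. a * x1 s ^ 4 - 1)"
    "A21 = (\<lambda>s. 1 + b * (y2 s)\<^sup>2 * ((x1 s)\<^sup>2 + x1 s * x2 s + (x2 s)\<^sup>2)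
        + c * (x1 s ^ 4 + x1 s ^ 3 * x2 s + (x1 s)\<^sup>2 * (x2 s)\<^sup>2 + x1 s * x2 s ^ 3 + x2 s ^ 4))"
    "A22 = (\<lambda>s. b * x1 s ^ 3 * (y1 s + y2 s))"
  define p q where pq: "p = (\<lambda>s. x1 s - x2 s)" "q = (\<lambda>s. y1 s - y2 s)"
  have dp: "(p has_real_derivative A11 s * p s + A12 s * q s) (at s)"
    and dq: "(q has_real_derivative A21 s * p s + A22 s * q s) (at s)" if "s \<in> I" for s
  proof -
    have "(p has_real_derivative (- y1 s + a * x1 s ^ 4 * y1 s) - (- y2 s + a * x2 s ^ 4 * y2 s)) (at s)"
      unfolding pq using that by (intro DERIV_diff dx1 dx2)
    moreover have "(- y1 s + a * x1 s ^ 4 * y1 s) - (- y2 s + a * x2 s ^ 4 * y2 s) = A11 s * p s + A12 s * q s"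
      unfolding pq A by algebra
    ultimately show "(p has_real_derivative A11 s * p s + A12 s * q s) (at s)" by simp
    have "(q has_real_derivative (x1 s + b * x1 s ^ 3 * (y1 s)\<^sup>2 + c * x1 s ^ 5)
        - (x2 s + b * x2 s ^ 3 * (y2 s)\<^sup>2 + c * x2 s ^ 5)) (at s)"
      unfolding pq using that by (intro DERIV_diff dy1 dy2)
    moreover have "(x1 s + b * x1 s ^ 3 * (y1 s)\<^sup>2 + c * x1 s ^ 5)
        - (x2 s + b * x2 s ^ 3 * (y2 s)\<^sup>2 + c * x2 s ^ 5) = A21 s * p s + A22 s * q s"
      unfolding pq A by algebra
    ultimately show "(q has_real_derivative A21 s * p s + A22 s * q s) (at s)" by simp
  qed
  have "(p t)\<^sup>2 + (q t)\<^sup>2 = 0"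
  proof (rule gronwall_zero[OF I, of "\<lambda>s. (p s)\<^sup>2 + (q s)\<^sup>2"
        "\<lambda>s. 2 * (p s * (A11 s * p s + A12 s * q s) + q s * (A21 s * p s + A22 s * q s))"
        "\<lambda>s. 2 * (\<bar>A11 s\<bar> + \<bar>A12 s\<bar> + \<bar>A21 s\<bar> + \<bar>A22 s\<bar>)"])
    show "((\<lambda>s. (p s)\<^sup>2 + (q s)\<^sup>2) has_real_derivative
        2 * (p s * (A11 s * p s + A12 s * q s) + q s * (A21 s * p s + A22 s * q s))) (at s)"
      if "s \<in> I" for s
      using that by (auto intro!: derivative_eq_intros dp dq simp: algebra_simps)
    show "\<bar>2 * (p s * (A11 s * p s + A12 s * q s) + q s * (A21 s * p s + A22 s * q s))\<bar>
        \<le> 2 * (\<bar>A11 s\<bar> + \<bar>A12 s\<bar> + \<bar>A21 s\<bar> + \<bar>A22 s\<bar>) * ((p s)\<^sup>2 + (q s)\<^sup>2)" for s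
      by (rule quadratic_form_bound)
    show "continuous_on I (\<lambda>s. 2 * (\<bar>A11 s\<bar> + \<bar>A12 s\<bar> + \<bar>A21 s\<bar> + \<bar>A22 s\<bar>))"
      unfolding A by (intro continuous_intros cont)
  qed (use eq in \<open>auto simp: pq xy\<close>)
  then show ?thesis by (simp add: pq xy prod_eq_iff sum_power2_eq_zero_iff)
qed

lemma orbitI:
  assumes "open I" "is_interval I" "0 \<in> I" "t \<in> I" "solution_on X I \<gamma>" "\<gamma> 0 = q"
  shows "\<gamma> t \<in> orbit X q"
  unfolding orbit_def mem_Collect_eq
  by (intro exI[of _ \<gamma>] exI[of _ t] exI[of _ I] conjI refl assms)

text \<open>By uniqueness every local solution through \<open>\<gamma> s\<close> is a restriction of
  a time shift of \<gamma>, so local solutions reach nothing new.\<close>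

lemma quintic_orbit_eq_range:
  assumes "solution_on (quintic_field a b c) UNIV \<gamma>"
  shows "orbit (quintic_field a b c) (\<gamma> s) = range \<gamma>"
proof -
  let ?\<gamma> = "\<lambda>t. \<gamma> (t + s)"
  have sol: "solution_on (quintic_field a b c) UNIV ?\<gamma>"
    using assms by (rule solution_on_shift)
  have "orbit (quintic_field a b c) (\<gamma> s) = range ?\<gamma>"
  proof
    show "orbit (quintic_field a b c) (\<gamma> s) \<subseteq> range ?\<gamma>"
    proof
      fix z assume "z \<in> orbit (quintic_field a b c) (\<gamma> s)"
      then obtain \<delta> t I where *: "z = \<delta> t" "is_interval I" "0 \<in> I" "t \<in> I"
        "solution_on (quintic_field a b c) I \<delta>" "\<delta> 0 = \<gamma> s"
        unfolding orbit_def by auto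
      have "solution_on (quintic_field a b c) I ?\<gamma>" using sol by (simp add: solution_on_def)
      then have "\<delta> t = ?\<gamma> t" using quintic_solution_unique[OF *(2-5)] *(6) by simp
      then show "z \<in> range ?\<gamma>" using *(1) by simp
    qed
    show "range ?\<gamma> \<subseteq> orbit (quintic_field a b c) (\<gamma> s)"
    proof
      fix z assume "z \<in> range ?\<gamma>"
      then obtain t where "z = ?\<gamma> t" by auto
      then show "z \<in> orbit (quintic_field a b c) (\<gamma> s)"
        using orbitI[of UNIV t _ ?\<gamma> "\<gamma> s"] sol is_interval_univ by simp
    qed
  qed
  also have "\<dots> = range \<gamma>" by (rule range_shift)
  finally show ?thesis .
qed

text \<open>A periodic solution that sweeps out the orbit of \<open>q\<close> need not be known to
  pass through \<open>q\<close>. But the orbit, being a range, is nonempty, so some local solution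
  starts at \<open>q\<close>; hence \<open>q\<close> lies on its own orbit, and a time shift puts it
  at time 0.\<close>

lemma cycle_orbit_solution:
  assumes "is_cycle X (orbit X q)"
  obtains \<gamma> T where "solution_on X UNIV \<gamma>" "\<gamma> 0 = q" "periodic_with T \<gamma>" "orbit X q = range \<gamma>"
proof -
  obtain \<gamma> T where \<gamma>: "solution_on X UNIV \<gamma>" "periodic_with T \<gamma>" "orbit X q = range \<gamma>"
    using assms unfolding is_cycle_def by auto
  then have "\<gamma> 0 \<in> orbit X q" by simp
  then obtain \<delta> s I where \<delta>: "open I" "is_interval I" "0 \<in> I" "solution_on X I \<delta>" "\<delta> 0 = q"
    unfolding orbit_def by auto
  then have "q \<in> orbit X q"
    using orbitI[of I 0 X \<delta> q] by simp
  then obtain s where s: "\<gamma> s = q" using \<gamma>(3) by auto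
  show thesis
  proof (rule that)
    show "solution_on X UNIV (\<lambda>t. \<gamma> (t + s))" using \<gamma>(1) by (rule solution_on_shift)
    show "periodic_with T (\<lambda>t. \<gamma> (t + s))"
      unfolding periodic_with_def
    proof (intro conjI allI)
      fix t
      have "\<gamma> (t + T + s) = \<gamma> (t + s + T)" by (simp add: algebra_simps)
      then show "\<gamma> (t + T + s) = \<gamma> (t + s)" using \<gamma>(2) by (simp add: periodic_with_def)
    qed (use \<gamma>(2) in \<open>simp add: periodic_with_def\<close>)
    show "orbit X q = range (\<lambda>t. \<gamma> (t + s))" using \<gamma>(3) by (simp add: range_shift)
  qed (use s in auto)
qed

section \<open>Least periods and the value of the period function\<close>

text \<open>By continuity a limit of periods is again a period, so the infimum is attained unless it
  is 0. Periods tending to 0 would give vanishing difference quotients at 0, against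
  \<open>v \<noteq> 0\<close>.\<close>

lemma least_period_exists:
  fixes \<gamma> :: "real \<Rightarrow> 'a::real_normed_vector"
  assumes d: "(\<gamma> has_vector_derivative v) (at 0)" "v \<noteq> 0"
    and cont: "continuous_on UNIV \<gamma>"
    and "periodic_with T0 \<gamma>"
  obtains T where "periodic_with T \<gamma>" "\<And>S. periodic_with S \<gamma> \<Longrightarrow> T \<le> S"
proof -
  define S where "S = {T. periodic_with T \<gamma>}"
  have S: "S \<noteq> {}" "bdd_below S"
    using assms(4) by (auto simp: S_def periodic_with_def intro!: bdd_belowI[of _ 0])
  have le: "Inf S \<le> s" if "periodic_with s \<gamma>" for s
    using S(2) that by (auto simp: S_def intro: cInf_lower)
  obtain f where f: "\<And>n. f n \<in> S" "f \<longlonglongrightarrow> Inf S"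
    using closure_contains_Inf[OF S] unfolding closure_sequential by auto
  have fpos: "f n > 0" and fper: "\<gamma> (t + f n) = \<gamma> t" for n t
    using f(1)[of n] by (auto simp: S_def periodic_with_def)
  have "Inf S \<ge> 0" using fpos f(2) by (meson LIMSEQ_le_const less_imp_le)
  moreover have "Inf S \<noteq> 0"
  proof
    assume "Inf S = 0"
    then have "filterlim f (at 0) sequentially"
      using f(2) fpos by (auto simp: filterlim_at intro!: always_eventually) (metis less_irrefl)
    moreover have "((\<lambda>h. (1 / \<bar>h\<bar>) *\<^sub>R (\<gamma> (0 + h) - (\<gamma> 0 + h *\<^sub>R v))) \<longlongrightarrow> 0) (at 0)"
      using d(1) by (simp add: has_vector_derivative_def has_derivative_at2)
    ultimately have "(\<lambda>n. (1 / \<bar>f n\<bar>) *\<^sub>R (\<gamma> (0 + f n) - (\<gamma> 0 + f n *\<^sub>R v))) \<longlonglongrightarrow> 0"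
      by (rule filterlim_compose[rotated])
    moreover have "(1 / \<bar>f n\<bar>) *\<^sub>R (\<gamma> (0 + f n) - (\<gamma> 0 + f n *\<^sub>R v)) = - v" for n
      using fpos[of n] unfolding fper by simp
    ultimately have "(\<lambda>n. - v) \<longlonglongrightarrow> 0" by simp
    then show False using d(2) by (simp add: LIMSEQ_const_iff)
  qed
  moreover have "\<gamma> (t + Inf S) = \<gamma> t" for t
  proof -
    have "isCont \<gamma> (t + Inf S)" using cont by (simp add: continuous_on_eq_continuous_at)
    then have "(\<lambda>n. \<gamma> (t + f n)) \<longlonglongrightarrow> \<gamma> (t + Inf S)"
      using f(2) by (intro isCont_tendsto_compose[of _ \<gamma>] tendsto_intros)
    then show ?thesis unfolding fper by (simp add: LIMSEQ_const_iff)
  qed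
  ultimately have "periodic_with (Inf S) \<gamma>" by (simp add: periodic_with_def)
  then show thesis using le that by blast
qed

text \<open>\<open>LEAST\<close> over the reals is informative only when a minimum exists.
  \<open>least_period_exists\<close> provides it for one solution, and uniqueness makes that
  solution the only candidate.\<close>

lemma quintic_period_function_attained:
  assumes cyc: "is_cycle (quintic_field a b c) (orbit (quintic_field a b c) q)"
    and q: "quintic_field a b c q \<noteq> 0"
  obtains \<gamma> where "solution_on (quintic_field a b c) UNIV \<gamma>" "\<gamma> 0 = q"
    "periodic_with (period_function (quintic_field a b c) q) \<gamma>"
proof -
  let ?X = "quintic_field a b c"
  obtain \<gamma> T0 where \<gamma>: "solution_on ?X UNIV \<gamma>" "\<gamma> 0 = q" "periodic_with T0 \<gamma>"
    using cycle_orbit_solution[OF cyc] by blast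
  have "(\<gamma> has_vector_derivative ?X q) (at 0)" using \<gamma>(1,2) by (auto simp: solution_on_def)
  then obtain T where T: "periodic_with T \<gamma>" "\<And>S. periodic_with S \<gamma> \<Longrightarrow> T \<le> S"
    using least_period_exists[OF _ q solution_on_continuous[OF \<gamma>(1)] \<gamma>(3)] by metis
  have "period_function ?X q = T"
    unfolding period_function_def
  proof (rule Least_equality)
    show "\<exists>\<gamma>. solution_on ?X UNIV \<gamma> \<and> \<gamma> 0 = q \<and> periodic_with T \<gamma>" using \<gamma> T by blast
    fix S assume "\<exists>\<delta>. solution_on ?X UNIV \<delta> \<and> \<delta> 0 = q \<and> periodic_with S \<delta>"
    then obtain \<delta> where \<delta>: "solution_on ?X UNIV \<delta>" "\<delta> 0 = q" "periodic_with S \<delta>" by auto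
    have "\<delta> t = \<gamma> t" for t
      using quintic_solution_unique[OF is_interval_univ UNIV_I UNIV_I \<delta>(1) \<gamma>(1), of 0] \<delta>(2) \<gamma>(2) by simp
    then have "\<delta> = \<gamma>" by auto
    then show "T \<le> S" using T \<delta> by simp
  qed
  then show thesis using that \<gamma> T by auto
qed

section \<open>Rotation near the origin\<close>

lemma quintic_solution_nonzero:
  assumes "solution_on (quintic_field a b c) UNIV \<gamma>" "\<gamma> 0 \<noteq> 0"
  shows "\<gamma> t \<noteq> 0"
proof
  assume "\<gamma> t = 0"
  have "solution_on (quintic_field a b c) UNIV (\<lambda>_. 0)"
    by (simp add: solution_on_quintic_iff)
  then have "\<gamma> 0 = 0"
    using quintic_solution_unique[OF is_interval_univ UNIV_I UNIV_I assms(1), of "\<lambda>_. 0" t 0] \<open>\<gamma> t = 0\<close> by simp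
  with assms(2) show False by simp
qed

text \<open>The linear part is a rotation and preserves \<open>D\<close>; the other terms have
  degree 5, so \<open>D'\<close> has degree 6 and is \<open>O(D^3)\<close>, and the derivative
  \<open>- 2 D' / D^3\<close> of \<open>1 / D^2\<close> is bounded. Thus an orbit that starts close
  enough to the origin stays close for any prescribed time.\<close>

lemma quintic_radius_lipschitz:
  assumes sol: "solution_on (quintic_field a b c) UNIV \<gamma>" and nz: "\<gamma> 0 \<noteq> 0"
  defines "D \<equiv> \<lambda>t. (fst (\<gamma> t))\<^sup>2 + (snd (\<gamma> t))\<^sup>2"
  shows "\<bar>1 / (D t)\<^sup>2 - 1 / (D 0)\<^sup>2\<bar> \<le> 4 * (\<bar>a\<bar> + \<bar>b\<bar> + \<bar>c\<bar>) * \<bar>t\<bar>"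
proof -
  define x y where xy: "x = (\<lambda>t. fst (\<gamma> t))" "y = (\<lambda>t. snd (\<gamma> t))"
  have dx: "(x has_real_derivative - y s + a * x s ^ 4 * y s) (at s)"
    and dy: "(y has_real_derivative x s + b * x s ^ 3 * (y s)\<^sup>2 + c * x s ^ 5) (at s)" for s
    using sol unfolding solution_on_quintic_iff xy by auto
  have D: "D = (\<lambda>t. (x t)\<^sup>2 + (y t)\<^sup>2)" by (simp add: D_def xy)
  have Dpos: "D s > 0" for s
    using quintic_solution_nonzero[OF sol nz, of s]
    by (simp add: D_def prod_eq_iff sum_power2_gt_zero_iff)
  define D' where "D' = (\<lambda>s. 2 * ((a + c) * (x s ^ 5 * y s) + b * (x s ^ 3 * y s ^ 3)))"
  have dD: "(D has_real_derivative D' s) (at s)" for s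
  proof -
    have "(D has_real_derivative 2 * x s * (- y s + a * x s ^ 4 * y s)
        + 2 * y s * (x s + b * x s ^ 3 * (y s)\<^sup>2 + c * x s ^ 5)) (at s)"
      unfolding D by (rule derivative_eq_intros dx dy refl | simp)+
    moreover have "2 * x s * (- y s + a * x s ^ 4 * y s)
        + 2 * y s * (x s + b * x s ^ 3 * (y s)\<^sup>2 + c * x s ^ 5) = D' s"
      unfolding D'_def by algebra
    ultimately show ?thesis by simp
  qed
  have D'_bound: "\<bar>D' s\<bar> \<le> 2 * (\<bar>a\<bar> + \<bar>b\<bar> + \<bar>c\<bar>) * D s ^ 3" for s
  proof -
    define \<rho> where "\<rho> = sqrt (D s)"
    have \<rho>: "\<bar>x s\<bar> \<le> \<rho>" "\<bar>y s\<bar> \<le> \<rho>" "\<rho> \<ge> 0" "\<rho>\<^sup>2 = D s"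
      using Dpos[of s] by (auto simp: \<rho>_def D intro!: real_le_rsqrt)
    have \<rho>6: "\<rho> ^ 6 = D s ^ 3" by (simp flip: \<rho>(4) power_mult)
    have "\<bar>x s ^ 5 * y s\<bar> \<le> \<rho> ^ 5 * \<rho>"
      unfolding abs_mult power_abs using \<rho> by (intro mult_mono power_mono) auto
    moreover have "\<rho> ^ 5 * \<rho> = D s ^ 3" unfolding \<rho>6[symmetric] by algebra
    ultimately have 1: "\<bar>x s ^ 5 * y s\<bar> \<le> D s ^ 3" by simp
    have "\<bar>x s ^ 3 * y s ^ 3\<bar> \<le> \<rho> ^ 3 * \<rho> ^ 3"
      unfolding abs_mult power_abs using \<rho> by (intro mult_mono power_mono) auto
    moreover have "\<rho> ^ 3 * \<rho> ^ 3 = D s ^ 3" unfolding \<rho>6[symmetric] by algebra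
    ultimately have 2: "\<bar>x s ^ 3 * y s ^ 3\<bar> \<le> D s ^ 3" by simp
    have "\<bar>(a + c) * (x s ^ 5 * y s)\<bar> \<le> (\<bar>a\<bar> + \<bar>c\<bar>) * D s ^ 3"
      unfolding abs_mult[of "a + c"] by (intro mult_mono 1) auto
    moreover have "\<bar>b * (x s ^ 3 * y s ^ 3)\<bar> \<le> \<bar>b\<bar> * D s ^ 3"
      unfolding abs_mult[of b] by (intro mult_mono 2) auto
    ultimately show ?thesis unfolding D'_def by (simp add: distrib_right)
  qed
  have "norm (1 / (D t)\<^sup>2 - 1 / (D 0)\<^sup>2) \<le> 4 * (\<bar>a\<bar> + \<bar>b\<bar> + \<bar>c\<bar>) * norm (t - 0)"
  proof (rule field_differentiable_bound[of UNIV "\<lambda>s. 1 / (D s)\<^sup>2" "\<lambda>s. - 2 * D' s / D s ^ 3"])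
    show "((\<lambda>s. 1 / (D s)\<^sup>2) has_field_derivative - 2 * D' s / D s ^ 3) (at s within UNIV)" for s
      using Dpos[of s] by (auto intro!: derivative_eq_intros dD simp: power2_eq_square power3_eq_cube)
    show "norm (- 2 * D' s / D s ^ 3) \<le> 4 * (\<bar>a\<bar> + \<bar>b\<bar> + \<bar>c\<bar>)" for s
    proof -
      have "2 * \<bar>D' s\<bar> \<le> 4 * (\<bar>a\<bar> + \<bar>b\<bar> + \<bar>c\<bar>) * D s ^ 3" using D'_bound[of s] by (simp add: algebra_simps)
      then show ?thesis using Dpos[of s] by (simp add: abs_mult divide_le_eq)
    qed
  qed auto
  then show ?thesis by simp
qed

text \<open>In the frame turned by \<theta> both components of \<open>(p, q)\<close> satisfy
  \<open>w' = \<rho> w\<close>: the transverse one stays 0 and the radial one stays positive. So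
  \<theta> is a continuous polar angle of \<open>(p, q)\<close>, obtained without an inverse
  trigonometric function.\<close>

lemma polar_angle_lift:
  fixes p q \<theta> k \<rho> :: "real \<Rightarrow> real"
  assumes I: "is_interval I" "0 \<in> I" "t \<in> I"
    and dp: "\<And>s. s \<in> I \<Longrightarrow> (p has_real_derivative \<rho> s * p s - k s * q s) (at s)"
    and dq: "\<And>s. s \<in> I \<Longrightarrow> (q has_real_derivative k s * p s + \<rho> s * q s) (at s)"
    and \<theta>: "\<And>s. s \<in> I \<Longrightarrow> (\<theta> has_real_derivative k s) (at s)" "\<theta> 0 = 0"
    and \<rho>: "continuous_on I \<rho>"
    and init: "p 0 > 0" "q 0 = 0"
  shows "q t * cos (\<theta> t) = p t * sin (\<theta> t)" "p t * cos (\<theta> t) + q t * sin (\<theta> t) > 0"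
proof -
  have "q t * cos (\<theta> t) - p t * sin (\<theta> t) = 0"
  proof (rule linear_ode_zero[OF I])
    show "((\<lambda>s. q s * cos (\<theta> s) - p s * sin (\<theta> s)) has_real_derivative
        \<rho> s * (q s * cos (\<theta> s) - p s * sin (\<theta> s))) (at s)" if "s \<in> I" for s
      using that by (auto intro!: derivative_eq_intros dp dq \<theta> simp: algebra_simps)
  qed (use \<rho> init \<theta>(2) in auto)
  then show "q t * cos (\<theta> t) = p t * sin (\<theta> t)" by simp
  show "p t * cos (\<theta> t) + q t * sin (\<theta> t) > 0"
  proof (rule linear_ode_pos[OF I])
    show "((\<lambda>s. p s * cos (\<theta> s) + q s * sin (\<theta> s)) has_real_derivative
        \<rho> s * (p s * cos (\<theta> s) + q s * sin (\<theta> s))) (at s)" if "s \<in> I" for s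
      using that by (auto intro!: derivative_eq_intros dp dq \<theta> simp: algebra_simps)
  qed (use \<rho> init \<theta>(2) in auto)
qed

lemma has_antiderivative:
  fixes k :: "real \<Rightarrow> real"
  assumes "continuous_on {u..v} k"
  obtains \<theta> where "\<theta> z = 0" "\<And>s. s \<in> {u<..<v} \<Longrightarrow> (\<theta> has_real_derivative k s) (at s)"
proof (rule that[of "\<lambda>s. integral {u..s} k - integral {u..z} k"])
  fix s assume s: "s \<in> {u<..<v}"
  have "((\<lambda>s. integral {u..s} k) has_real_derivative k s) (at s within {u..v})"
    using s by (intro integral_has_real_derivative assms) auto
  then have "((\<lambda>s. integral {u..s} k) has_real_derivative k s) (at s)"
    using s at_within_interior[of s "{u..v}"] by simp
  then show "((\<lambda>s. integral {u..s} k - integral {u..z} k) has_real_derivative k s) (at s)"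
    by (auto intro!: derivative_eq_intros)
qed simp

text \<open>The angle \<theta> of \<open>(P, y)\<close> grows by \<open>2 pi n\<close> over a
  period, and its speed differs from 1 by \<open>(h - 1) y^2 / N\<close>, hence by at most
  \<epsilon>. If the growth were exactly \<open>T\<close>, then \<open>\<theta> s - s\<close>,
  monotone by the sign hypothesis and 0 at both ends, would be constant; this forces
  \<open>x y = 0\<close> throughout the period, although \<open>x y\<close> increases strictly at
  time 0. The margin 1 around \<open>{0..T}\<close> keeps 0 and \<open>T\<close> interior, so that
  derivatives there are two-sided.\<close>

lemma quintic_rotation_estimate:
  fixes a b c :: real
  defines "h \<equiv> \<lambda>x. 1 + (5 * c - a + b) * x ^ 4 + c * (b - 5 * a) * x ^ 8"
  assumes sol: "solution_on (quintic_field a b c) UNIV \<gamma>" and init: "\<gamma> 0 = (r, 0)" "r > 0"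
    and per: "periodic_with T \<gamma>"
    and small: "\<And>t. t \<in> {-1..T + 1} \<Longrightarrow> \<bar>fst (\<gamma> t)\<bar> < \<eta>"
    and cpos: "\<And>x. \<bar>x\<bar> < \<eta> \<Longrightarrow> 1 + c * x ^ 4 > 0"
    and eps: "\<And>x. \<bar>x\<bar> < \<eta> \<Longrightarrow> \<bar>h x - 1\<bar> \<le> \<epsilon>"
    and sign: "\<And>x. \<bar>x\<bar> < \<eta> \<Longrightarrow> x \<noteq> 0 \<Longrightarrow> \<sigma> * (h x - 1) > 0"
  shows "\<exists>n::int. 2 * pi * n \<noteq> T \<and> \<bar>2 * pi * n - T\<bar> \<le> \<epsilon> * T"
proof -
  have T: "T > 0" using per by (simp add: periodic_with_def)
  define x y where xy: "x = (\<lambda>t. fst (\<gamma> t))" "y = (\<lambda>t. snd (\<gamma> t))"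
  have dx: "(x has_real_derivative - y s + a * x s ^ 4 * y s) (at s)"
    and dy: "(y has_real_derivative x s + b * x s ^ 3 * (y s)\<^sup>2 + c * x s ^ 5) (at s)" for s
    using sol unfolding solution_on_quintic_iff xy by auto
  have x0: "x 0 = r" "y 0 = 0" "x T = r" "y T = 0"
    using init per by (auto simp: xy periodic_with_def) (metis add_0 fst_conv snd_conv)+
  have cont: "continuous_on S x" "continuous_on S y" for S
    using dx dy by (meson DERIV_isCont continuous_at_imp_continuous_on)+
  define P dP dY where PQ: "P = (\<lambda>s. x s + c * x s ^ 5)"
    "dP = (\<lambda>s. (1 + 5 * c * x s ^ 4) * (- y s + a * x s ^ 4 * y s))"
    "dY = (\<lambda>s. x s + b * x s ^ 3 * (y s)\<^sup>2 + c * x s ^ 5)"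
  have dP: "(P has_real_derivative dP s) (at s)" for s
    unfolding PQ by (rule derivative_eq_intros dx refl | simp add: algebra_simps)+
  define N where "N = (\<lambda>s. (P s)\<^sup>2 + (y s)\<^sup>2)"
  \<comment> \<open>The angular speed of \<open>(P, y)\<close> and the logarithmic growth rate of
    its length.\<close>
  define k \<rho> where k: "k = (\<lambda>s. ((P s)\<^sup>2 + h (x s) * (y s)\<^sup>2) / N s)"
    and \<rho>: "\<rho> = (\<lambda>s. (P s * dP s + y s * dY s) / N s)"
  have Npos: "N s > 0" if "s \<in> {-1..T + 1}" for s
  proof -
    have "\<gamma> s \<noteq> 0" using quintic_solution_nonzero[OF sol] init by (auto simp: zero_prod_def)
    then have "x s \<noteq> 0 \<or> y s \<noteq> 0" by (auto simp: xy prod_eq_iff)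
    moreover have "P s = x s * (1 + c * x s ^ 4)" unfolding PQ by algebra
    \<comment> \<open>This factor keeps \<open>P\<close> from vanishing away from
      \<open>x = 0\<close>, so \<open>(P, y)\<close> has a well-defined angle.\<close>
    moreover have "1 + c * x s ^ 4 > 0" using cpos small[OF that] by (simp add: xy)
    ultimately have "P s \<noteq> 0 \<or> y s \<noteq> 0" by auto
    then show ?thesis by (simp add: N_def sum_power2_gt_zero_iff)
  qed
  have kcont: "continuous_on {-1..T + 1} k" and \<rho>cont: "continuous_on {-1..T + 1} \<rho>"
    unfolding k \<rho> using Npos unfolding N_def PQ h_def
    by (auto intro!: continuous_intros cont simp: less_imp_neq[THEN not_sym]) (force+)?
  obtain \<theta> where \<theta>: "\<theta> 0 = 0" "\<And>s. s \<in> {-1<..<T + 1} \<Longrightarrow> (\<theta> has_real_derivative k s) (at s)"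
    using has_antiderivative[OF kcont] by blast
  let ?I = "{-1<..<T + 1}"
  have cross: "(P s)\<^sup>2 + h (x s) * (y s)\<^sup>2 = P s * dY s - y s * dP s" for s
    unfolding PQ h_def by algebra
  have eq: "\<rho> s * P s - k s * y s = dP s" "k s * P s + \<rho> s * y s = dY s" if "s \<in> ?I" for s
  proof -
    have N: "N s \<noteq> 0" using Npos[of s] that by auto
    have "\<rho> s * P s - k s * y s = (P s * (P s * dP s + y s * dY s) - y s * (P s * dY s - y s * dP s)) / N s"
      unfolding k \<rho> cross using N by (simp add: field_simps)
    also have "P s * (P s * dP s + y s * dY s) - y s * (P s * dY s - y s * dP s) = dP s * N s"
      unfolding N_def by algebra
    finally show "\<rho> s * P s - k s * y s = dP s" using N by simp
    have "k s * P s + \<rho> s * y s = (P s * (P s * dY s - y s * dP s) + y s * (P s * dP s + y s * dY s)) / N s"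
      unfolding k \<rho> cross using N by (simp add: field_simps)
    also have "P s * (P s * dY s - y s * dP s) + y s * (P s * dP s + y s * dY s) = dY s * N s"
      unfolding N_def by algebra
    finally show "k s * P s + \<rho> s * y s = dY s" using N by simp
  qed
  have "1 + c * r ^ 4 > 0" using cpos small[of 0] T x0 by (simp add: xy)
  then have "r * (1 + c * r ^ 4) > 0" using init by simp
  moreover have "r * (1 + c * r ^ 4) = P T" unfolding PQ x0 by algebra
  ultimately have PT: "P T > 0" by simp
  moreover have "y T * cos (\<theta> T) = P T * sin (\<theta> T)" "P T * cos (\<theta> T) + y T * sin (\<theta> T) > 0"
  proof -
    have "(P has_real_derivative \<rho> s * P s - k s * y s) (at s)"
      "(y has_real_derivative k s * P s + \<rho> s * y s) (at s)" if "s \<in> ?I" for s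
      using dP[of s] dy[of s] unfolding eq[OF that] PQ(3) by auto
    moreover have "continuous_on ?I \<rho>" using \<rho>cont by (rule continuous_on_subset) auto
    moreover have "P 0 > 0" using PT by (simp add: PQ x0)
    ultimately show "y T * cos (\<theta> T) = P T * sin (\<theta> T)" "P T * cos (\<theta> T) + y T * sin (\<theta> T) > 0"
      using T \<theta> x0 by (intro polar_angle_lift[of ?I T P \<rho> k y \<theta>]; simp add: is_interval_1)+
  qed
  ultimately have "sin (\<theta> T) = 0" "cos (\<theta> T) > 0" using x0 by (auto simp: zero_less_mult_iff)
  then have "cos (\<theta> T) = 1" using sin_zero_abs_cos_one by fastforce
  then obtain n :: int where n: "\<theta> T = 2 * pi * n" by (auto simp: cos_one_2pi_int mult_ac)
  have k1: "k s - 1 = (h (x s) - 1) * ((y s)\<^sup>2 / N s)" if "s \<in> ?I" for s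
  proof -
    have "k s - 1 = ((P s)\<^sup>2 + h (x s) * (y s)\<^sup>2 - N s) / N s"
      using Npos[of s] that by (simp add: k diff_divide_distrib)
    then show ?thesis by (simp add: N_def algebra_simps)
  qed
  have y1: "0 \<le> (y s)\<^sup>2 / N s" "(y s)\<^sup>2 / N s \<le> 1" if "s \<in> ?I" for s
    using Npos[of s] that by (auto simp: N_def)
  have xs: "\<bar>x s\<bar> < \<eta>" if "s \<in> ?I" for s using small[of s] that by (simp add: xy)
  have d\<theta>: "((\<lambda>s. \<theta> s - s) has_real_derivative k s - 1) (at s)" if "s \<in> ?I" for s
    using that by (auto intro!: derivative_eq_intros \<theta>)
  have "norm ((\<theta> T - T) - (\<theta> 0 - 0)) \<le> \<epsilon> * norm (T - 0)"
  proof (rule field_differentiable_bound[of ?I "\<lambda>s. \<theta> s - s" "\<lambda>s. k s - 1"])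
    show "norm (k s - 1) \<le> \<epsilon>" if "s \<in> ?I" for s
    proof -
      have "\<bar>k s - 1\<bar> = \<bar>h (x s) - 1\<bar> * ((y s)\<^sup>2 / N s)"
        unfolding k1[OF that] abs_mult using y1(1)[OF that] by (simp only: abs_of_nonneg)
      also have "\<dots> \<le> \<bar>h (x s) - 1\<bar> * 1" using y1[OF that] by (intro mult_left_mono) auto
      finally show ?thesis using eps[OF xs[OF that]] by simp
    qed
  qed (use T d\<theta> in \<open>auto intro: has_field_derivative_at_within\<close>)
  then have "\<bar>2 * pi * n - T\<bar> \<le> \<epsilon> * T" using n \<theta>(1) T by simp
  moreover have "2 * pi * n \<noteq> T"
  proof
    assume "2 * pi * n = T"
    define \<psi> where "\<psi> = (\<lambda>s. \<sigma> * (\<theta> s - s))"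
    have d\<psi>: "(\<psi> has_real_derivative \<sigma> * (k s - 1)) (at s)" if "s \<in> ?I" for s
      unfolding \<psi>_def using that by (intro DERIV_cmult d\<theta>)
    have nonneg: "\<sigma> * (h (x s) - 1) \<ge> 0" if "s \<in> ?I" for s
    proof (cases "x s = 0")
      case True then show ?thesis by (simp add: h_def)
    next
      case False then show ?thesis using sign[OF xs[OF that]] by (simp add: less_imp_le)
    qed
    have d\<psi>_nonneg: "\<sigma> * (k s - 1) \<ge> 0" if "s \<in> ?I" for s
      using mult_nonneg_nonneg[OF nonneg[OF that] y1(1)[OF that]] k1[OF that] by (simp add: mult.assoc)
    have mono: "\<psi> u \<le> \<psi> v" if "0 \<le> u" "u \<le> v" "v \<le> T" for u v
      using that by (intro DERIV_nonneg_imp_nondecreasing[of u v \<psi>]) (auto intro!: exI conjI d\<psi> d\<psi>_nonneg)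
    have ends: "\<psi> 0 = 0" "\<psi> T = 0" using \<open>2 * pi * n = T\<close> n \<theta>(1) by (auto simp: \<psi>_def)
    have \<psi>0: "\<psi> s = 0" if "0 \<le> s" "s \<le> T" for s
      using mono[of 0 s] mono[of s T] that ends by simp
    have vanish: "x s * y s = 0" if s: "0 < s" "s < T" for s
    proof -
      have "\<sigma> * (k s - 1) = 0"
      proof (rule DERIV_local_const[of \<psi> _ s "min s (T - s)"])
        show "\<forall>u. \<bar>s - u\<bar> < min s (T - s) \<longrightarrow> \<psi> s = \<psi> u" using s by (auto simp: \<psi>0 abs_if split: if_splits)
      qed (use s d\<psi> in auto)
      moreover have "\<sigma> * (h (x s) - 1) > 0" if "x s \<noteq> 0" using sign[OF xs that] s by simp
      ultimately show ?thesis using k1[of s] s Npos[of s] by (cases "x s = 0") auto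
    qed
    \<comment> \<open>At time 0 the orbit crosses the x-axis transversally, since
      \<open>y 0 = 0\<close> and \<open>y\<close> has derivative \<open>P 0 > 0\<close>
      there.\<close>
    have "((\<lambda>s. x s * y s) has_real_derivative r * P 0) (at 0)"
      by (rule derivative_eq_intros dx dy refl | simp add: x0 PQ)+
    moreover have "P 0 = P T" by (simp add: PQ x0)
    ultimately obtain d where d: "d > 0" "\<And>s. s > 0 \<Longrightarrow> s < d \<Longrightarrow> x 0 * y 0 < x (0 + s) * y (0 + s)"
      using DERIV_pos_inc_right[of "\<lambda>s. x s * y s" "r * P 0" 0] PT init(2) by auto
    have "min d T / 2 > 0" "min d T / 2 < d" "min d T / 2 < T" using d(1) T by auto
    then show False using d(2)[of "min d T / 2"] vanish[of "min d T / 2"] x0 by simp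
  qed
  ultimately show ?thesis by blast
qed

section \<open>Necessity: a common period near the origin forces \<open>h = 1\<close>\<close>

text \<open>After division by \<open>u\<close> this is discreteness of the integers. Whether
  \<open>T\<close> itself is a multiple is left open, since nothing is known about the common
  period.\<close>

lemma int_multiple_isolated:
  fixes T u :: real
  assumes "u > 0"
  obtains \<delta> where "\<delta> > 0" "\<And>n::int. \<bar>u * n - T\<bar> < \<delta> \<Longrightarrow> u * n = T"
proof -
  define \<tau> where "\<tau> = T / u"
  have T: "T = u * \<tau>" using assms by (simp add: \<tau>_def)
  obtain \<delta> where \<delta>: "\<delta> > 0" "\<And>n::int. \<bar>n - \<tau>\<bar> < \<delta> \<Longrightarrow> n = \<tau>"
  proof (cases "\<tau> \<in> \<int>")
    case True
    then obtain m :: int where m: "\<tau> = m" by (auto elim: Ints_cases)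
    have "real_of_int n = \<tau>" if "\<bar>real_of_int n - \<tau>\<bar> < 1" for n
    proof -
      have "real_of_int \<bar>n - m\<bar> < 1" using that by (simp add: m)
      then show ?thesis by (simp add: m)
    qed
    then show ?thesis by (intro that[of 1]) auto
  next
    case False
    then have "frac \<tau> > 0" by (simp add: frac_gt_0_iff)
    moreover have "frac \<tau> < 1" by (rule frac_lt_1)
    moreover have "\<bar>real_of_int n - \<tau>\<bar> \<ge> min (frac \<tau>) (1 - frac \<tau>)" for n
    proof (cases "n \<le> \<lfloor>\<tau>\<rfloor>")
      case True
      then have "real_of_int n \<le> of_int \<lfloor>\<tau>\<rfloor>" by simp
      then show ?thesis unfolding frac_def by linarith
    next
      case False
      then have "real_of_int n \<ge> of_int (\<lfloor>\<tau>\<rfloor> + 1)" by linarith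
      then show ?thesis unfolding frac_def by simp
    qed
    ultimately show ?thesis by (intro that[of "min (frac \<tau>) (1 - frac \<tau>)"]) (simp, meson not_less)
  qed
  show thesis
  proof (rule that[of "u * \<delta>"])
    fix n :: int assume "\<bar>u * n - T\<bar> < u * \<delta>"
    moreover have "\<bar>u * n - T\<bar> = u * \<bar>n - \<tau>\<bar>"
      using assms by (simp add: T abs_mult flip: right_diff_distrib)
    ultimately show "u * n = T" using assms \<delta>(2)[of n] T by simp
  qed (use assms \<delta> in simp)
qed

text \<open>Near 0 the lowest nonvanishing coefficient decides the sign, on both sides of 0 because
  the exponents are even; \<sigma> is that coefficient.\<close>

lemma even_power_perturbation_sign:
  fixes \<alpha> \<beta> :: real
  assumes "\<alpha> \<noteq> 0 \<or> \<beta> \<noteq> 0"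
  obtains \<sigma> where "\<forall>\<^sub>F x in nhds 0. x \<noteq> 0 \<longrightarrow> \<sigma> * (\<alpha> * x ^ 4 + \<beta> * x ^ 8) > 0"
proof (cases "\<alpha> = 0")
  case True
  have "\<beta> * (\<alpha> * x ^ 4 + \<beta> * x ^ 8) > 0" if "x \<noteq> 0" for x
  proof -
    have "(\<beta> * x ^ 4)\<^sup>2 > 0" using True assms that by simp
    moreover have "(\<beta> * x ^ 4)\<^sup>2 = \<beta> * (\<beta> * x ^ 8)" by algebra
    ultimately show ?thesis using True by simp
  qed
  then show ?thesis by (intro that[of \<beta>]) auto
next
  case False
  have "((\<lambda>x. \<alpha> * (\<alpha> + \<beta> * x ^ 4)) \<longlongrightarrow> \<alpha> * (\<alpha> + \<beta> * 0 ^ 4)) (nhds 0)"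
    by (intro tendsto_intros filterlim_ident)
  moreover have "\<alpha> * (\<alpha> + \<beta> * 0 ^ 4) > 0" using False by (simp add: zero_less_mult_iff) linarith
  ultimately have "\<forall>\<^sub>F x in nhds 0. \<alpha> * (\<alpha> + \<beta> * x ^ 4) > 0"
    by (rule order_tendstoD)
  then have "\<forall>\<^sub>F x in nhds 0. x \<noteq> 0 \<longrightarrow> \<alpha> * (\<alpha> * x ^ 4 + \<beta> * x ^ 8) > 0"
  proof (eventually_elim, intro impI)
    fix x :: real assume "\<alpha> * (\<alpha> + \<beta> * x ^ 4) > 0" "x \<noteq> 0"
    then have "x ^ 4 * (\<alpha> * (\<alpha> + \<beta> * x ^ 4)) > 0" by (subst zero_less_mult_iff) simp
    moreover have "x ^ 4 * (\<alpha> * (\<alpha> + \<beta> * x ^ 4)) = \<alpha> * (\<alpha> * x ^ 4 + \<beta> * x ^ 8)" by algebra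
    ultimately show "\<alpha> * (\<alpha> * x ^ 4 + \<beta> * x ^ 8) > 0" by simp
  qed
  then show ?thesis by (rule that)
qed

lemma quintic_common_period_imp:
  fixes a b c r0 T :: real
  assumes "r0 > 0" "T > 0"
    and per: "\<And>r. 0 < r \<Longrightarrow> r < r0 \<Longrightarrow>
      \<exists>\<gamma>. solution_on (quintic_field a b c) UNIV \<gamma> \<and> \<gamma> 0 = (r, 0) \<and> periodic_with T \<gamma>"
  shows "5 * c - a + b = 0 \<and> c * (b - 5 * a) = 0"
proof (rule ccontr)
  assume "\<not> ?thesis"
  then obtain \<sigma> where \<sigma>: "\<forall>\<^sub>F x in nhds 0. x \<noteq> 0 \<longrightarrow> \<sigma> * ((5 * c - a + b) * x ^ 4 + c * (b - 5 * a) * x ^ 8) > 0"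
    using even_power_perturbation_sign[of "5 * c - a + b" "c * (b - 5 * a)"] by auto
  obtain \<delta> where \<delta>: "\<delta> > 0" "\<And>n::int. \<bar>2 * pi * n - T\<bar> < \<delta> \<Longrightarrow> 2 * pi * n = T"
    using int_multiple_isolated[of "2 * pi" T] by auto
  \<comment> \<open>With this value, a speed error of at most \<epsilon> over a time
    \<open>T\<close> shifts the angle by at most half the gap \<delta>.\<close>
  define \<epsilon> where "\<epsilon> = \<delta> / (2 * T)"
  have \<epsilon>: "\<epsilon> > 0" "\<epsilon> * T < \<delta>" using \<delta> \<open>T > 0\<close> by (auto simp: \<epsilon>_def)
  have "((\<lambda>x. 1 + c * x ^ 4) \<longlongrightarrow> 1 + c * 0 ^ 4) (nhds 0)"
    "((\<lambda>x. \<bar>(5 * c - a + b) * x ^ 4 + c * (b - 5 * a) * x ^ 8\<bar>)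
        \<longlongrightarrow> \<bar>(5 * c - a + b) * 0 ^ 4 + c * (b - 5 * a) * 0 ^ 8\<bar>) (nhds 0)"
    by (intro tendsto_intros filterlim_ident)+
  then have "\<forall>\<^sub>F x in nhds 0. 1 + c * x ^ 4 > 0"
    "\<forall>\<^sub>F x in nhds 0. \<bar>(5 * c - a + b) * x ^ 4 + c * (b - 5 * a) * x ^ 8\<bar> < \<epsilon>"
    using \<epsilon>(1) by (auto dest: order_tendstoD(1)[of _ _ _ 0] order_tendstoD(2)[of _ _ _ \<epsilon>])
  with \<sigma> have "\<forall>\<^sub>F x in nhds 0. (x \<noteq> 0 \<longrightarrow> \<sigma> * ((5 * c - a + b) * x ^ 4 + c * (b - 5 * a) * x ^ 8) > 0)
      \<and> 1 + c * x ^ 4 > 0 \<and> \<bar>(5 * c - a + b) * x ^ 4 + c * (b - 5 * a) * x ^ 8\<bar> < \<epsilon>"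
    by eventually_elim auto
  then obtain \<eta> where \<eta>: "\<eta> > 0" "\<And>x. \<bar>x\<bar> < \<eta> \<Longrightarrow> x \<noteq> 0 \<Longrightarrow> \<sigma> * ((5 * c - a + b) * x ^ 4 + c * (b - 5 * a) * x ^ 8) > 0"
      "\<And>x. \<bar>x\<bar> < \<eta> \<Longrightarrow> 1 + c * x ^ 4 > 0"
      "\<And>x. \<bar>x\<bar> < \<eta> \<Longrightarrow> \<bar>(5 * c - a + b) * x ^ 4 + c * (b - 5 * a) * x ^ 8\<bar> < \<epsilon>"
    unfolding eventually_nhds_metric by (auto simp: dist_norm)
  \<comment> \<open>\<open>M\<close> bounds the change of \<open>1 / D^2\<close> over the times
    \<open>{-1..T + 1}\<close>. Hence \<open>r^4 < \<kappa>\<close> yields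
    \<open>1 / D^2 \<ge> 1 / r^4 - M > 1 / \<eta>^4\<close>, that is \<open>D < \<eta>^2\<close>,
    which keeps \<open>x\<close> in the range where the sign and size of \<open>h - 1\<close> are
    controlled.\<close>
  define M where "M = 4 * (\<bar>a\<bar> + \<bar>b\<bar> + \<bar>c\<bar>) * (T + 1)"
  have "M \<ge> 0" using \<open>T > 0\<close> by (simp add: M_def)
  define \<kappa> where "\<kappa> = 1 / (1 / \<eta> ^ 4 + M)"
  have \<kappa>: "\<kappa> > 0" using \<eta>(1) \<open>M \<ge> 0\<close> by (simp add: \<kappa>_def add_pos_nonneg)
  have "((\<lambda>r. r ^ 4) \<longlongrightarrow> 0 ^ 4) (at_right (0::real))" by (intro tendsto_intros)
  then have "\<forall>\<^sub>F r in at_right 0. r ^ 4 < \<kappa>" using \<kappa> by (intro order_tendstoD(2)[of _ 0]) simp_all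
  moreover have "\<forall>\<^sub>F r in at_right 0. r < r0" "\<forall>\<^sub>F r::real in at_right 0. 0 < r"
    using \<open>r0 > 0\<close> by (auto simp: eventually_at_right_less intro: eventually_at_rightI)
  ultimately have "\<forall>\<^sub>F r in at_right 0. r ^ 4 < \<kappa> \<and> r < r0 \<and> 0 < r" by eventually_elim auto
  then obtain r where r: "0 < r" "r < r0" "r ^ 4 < \<kappa>"
    using eventually_happens'[of "at_right (0::real)"] by auto
  obtain \<gamma> where \<gamma>: "solution_on (quintic_field a b c) UNIV \<gamma>" "\<gamma> 0 = (r, 0)" "periodic_with T \<gamma>"
    using per[OF r(1,2)] by blast
  have small: "\<bar>fst (\<gamma> t)\<bar> < \<eta>" if t: "t \<in> {-1..T + 1}" for t
  proof -
    define D where "D = (fst (\<gamma> t))\<^sup>2 + (snd (\<gamma> t))\<^sup>2"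
    have D: "D > 0"
      using quintic_solution_nonzero[OF \<gamma>(1), of t] \<gamma>(2) r(1)
      by (auto simp: D_def prod_eq_iff sum_power2_gt_zero_iff)
    have "\<bar>1 / D\<^sup>2 - 1 / r ^ 4\<bar> \<le> 4 * (\<bar>a\<bar> + \<bar>b\<bar> + \<bar>c\<bar>) * \<bar>t\<bar>"
      using quintic_radius_lipschitz[OF \<gamma>(1), of t] \<gamma>(2) r(1) by (simp add: D_def zero_prod_def flip: power_mult)
    also have "\<dots> \<le> M" unfolding M_def using t \<open>T > 0\<close> by (intro mult_left_mono) auto
    finally have "1 / r ^ 4 - M \<le> 1 / D\<^sup>2" by linarith
    moreover have "1 / \<kappa> < 1 / r ^ 4" using r \<kappa> by (intro divide_strict_left_mono) auto
    ultimately have "1 / \<eta> ^ 4 < 1 / D\<^sup>2" by (simp add: \<kappa>_def)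
    then have "D\<^sup>2 < (\<eta>\<^sup>2)\<^sup>2" using D \<eta>(1) by (simp add: frac_less_eq divide_less_cancel field_simps flip: power_mult)
    then have "D < \<eta>\<^sup>2" by (rule power_less_imp_less_base) simp
    then have "(fst (\<gamma> t))\<^sup>2 < \<eta>\<^sup>2" unfolding D_def by (smt (verit) zero_le_power2)
    then show ?thesis using \<eta>(1) by (metis power2_less_imp_less power2_abs less_imp_le)
  qed
  obtain n :: int where "2 * pi * n \<noteq> T" "\<bar>2 * pi * n - T\<bar> \<le> \<epsilon> * T"
    using quintic_rotation_estimate[OF \<gamma>(1,2) r(1) \<gamma>(3) small, where \<epsilon> = \<epsilon> and \<sigma> = \<sigma>] \<eta>(2,3,4)
    by (auto simp: less_imp_le add.assoc)
  then show False using \<delta>(2)[of n] \<epsilon>(2) by linarith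
qed

lemma quintic_isochronous_imp:
  assumes iso: "isochronous_center (quintic_field a b c) (0, 0)"
  shows "5 * c - a + b = 0 \<and> c * (b - 5 * a) = 0"
proof -
  let ?X = "quintic_field a b c"
  obtain T where cen: "is_center ?X (0, 0)"
    and T: "\<And>q. q \<in> period_annulus ?X (0, 0) - {(0, 0)} \<Longrightarrow> period_function ?X q = T"
    using iso unfolding isochronous_center_def by auto
  have ann: "cycle_covered_nbhd ?X (0, 0) (period_annulus ?X (0, 0))"
    by (rule period_annulus_greatest(1)[OF cen])
  then obtain e where e: "e > 0" "ball (0, 0) e \<subseteq> period_annulus ?X (0, 0)"
    unfolding cycle_covered_nbhd_def mem_interior by auto
  have "\<forall>\<^sub>F q in at (0, 0). ?X q \<noteq> 0"
    using cen unfolding is_center_def isolated_singular_point_def by auto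
  then obtain d where d: "d > 0" "\<And>q. q \<noteq> (0, 0) \<Longrightarrow> dist q (0, 0) < d \<Longrightarrow> ?X q \<noteq> 0"
    unfolding eventually_at by blast
  have ex: "\<exists>\<gamma>. solution_on ?X UNIV \<gamma> \<and> \<gamma> 0 = (r, 0) \<and> periodic_with T \<gamma>"
    if r: "0 < r" "r < min e d" for r
  proof -
    have q: "(r, 0) \<in> period_annulus ?X (0, 0) - {(0, 0)}"
      using e(2) r by (auto simp: dist_Pair_Pair)
    then have "is_cycle ?X (orbit ?X (r, 0))"
      using ann unfolding cycle_covered_nbhd_def cycle_around_def by blast
    moreover have "?X (r, 0) \<noteq> 0" using d(2)[of "(r, 0)"] r by (simp add: dist_Pair_Pair)
    ultimately show ?thesis
      using quintic_period_function_attained[of a b c "(r, 0)"] T[OF q] by metis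
  qed
  \<comment> \<open>The constant in \<open>isochronous_center\<close> is an arbitrary real; it is
    positive because it is a period of an actual orbit.\<close>
  have "0 < min e d / 2" "min e d / 2 < min e d" using e(1) d(1) by auto
  then have "T > 0" using ex[of "min e d / 2"] unfolding periodic_with_def by blast
  then show ?thesis
    using quintic_common_period_imp[of "min e d" T a b c] ex e(1) d(1) by auto
qed

section \<open>Linearization\<close>

locale linearizable_quintic =
  fixes a b c \<kappa> :: real
  assumes b_eq: "b = 4 * a * \<kappa>" and c_eq: "5 * c = a - b" and c_b: "c * (b - 5 * a) = 0"
begin

abbreviation X :: "real \<times> real \<Rightarrow> real \<times> real" where
  "X \<equiv> quintic_field a b c"

text \<open>In the coordinates \<open>(\<phi> x, m x y)\<close> the system is the rotation \<open>u' = -v\<close>, \<open>v' = u\<close> over the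
  strip. For \<open>a = 0\<close> also \<open>b = c = 0\<close>, and the coordinates are the identity.\<close>

definition strip :: "real set" where
  "strip = {x. 1 - a * x ^ 4 > 0}"

definition m :: "real \<Rightarrow> real" where
  "m x = (1 - a * x ^ 4) powr (- \<kappa>)"

definition \<phi> :: "real \<Rightarrow> real" where
  "\<phi> x = m x * (x + c * x ^ 5)"

text \<open>The strip is the whole line for \<open>a \<le> 0\<close> and an interval symmetric about
  0 otherwise.\<close>

lemma strip_between:
  assumes "x \<in> strip" "z \<in> strip" "x \<le> y" "y \<le> z"
  shows "y \<in> strip"
proof (cases "a \<le> 0")
  case True
  then have "a * y ^ 4 \<le> 0" by (simp add: mult_nonpos_nonneg)
  then show ?thesis by (simp add: strip_def)
next
  case False
  have "\<bar>y\<bar> \<le> \<bar>x\<bar> \<or> \<bar>y\<bar> \<le> \<bar>z\<bar>" using assms by linarith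
  then have "\<bar>y\<bar> ^ 4 \<le> \<bar>x\<bar> ^ 4 \<or> \<bar>y\<bar> ^ 4 \<le> \<bar>z\<bar> ^ 4" by (meson abs_ge_zero power_mono)
  then have "y ^ 4 \<le> x ^ 4 \<or> y ^ 4 \<le> z ^ 4" by simp
  then have "a * y ^ 4 \<le> a * x ^ 4 \<or> a * y ^ 4 \<le> a * z ^ 4"
    using False by (auto intro: mult_left_mono)
  then show ?thesis using assms(1,2) by (auto simp: strip_def)
qed

lemma m_pos: "x \<in> strip \<Longrightarrow> m x > 0"
  by (simp add: m_def strip_def)

lemma m_deriv:
  assumes "x \<in> strip"
  shows "(m has_real_derivative m x * b * x ^ 3 / (1 - a * x ^ 4)) (at x)"
proof -
  have w: "1 - a * x ^ 4 > 0" using assms by (simp add: strip_def)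
  have "((\<lambda>x. 1 - a * x ^ 4) has_real_derivative - (4 * a * x ^ 3)) (at x)"
    by (auto intro!: derivative_eq_intros)
  then have "((\<lambda>x. (1 - a * x ^ 4) powr (- \<kappa>)) has_real_derivative
      (- \<kappa>) * (1 - a * x ^ 4) powr (- \<kappa> - 1) * - (4 * a * x ^ 3)) (at x)"
    using DERIV_fun_powr[of "\<lambda>x. 1 - a * x ^ 4" "- (4 * a * x ^ 3)" x "- \<kappa>"] w by simp
  moreover have "(1 - a * x ^ 4) powr (- \<kappa> - 1) = m x / (1 - a * x ^ 4)"
    using w by (simp add: m_def powr_diff)
  ultimately show ?thesis
    unfolding m_def[abs_def, symmetric] by (simp add: b_eq m_def[symmetric] mult_ac)
qed

text \<open>For general coefficients the product rule gives \<open>m h / (1 - a x^4)\<close>; this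
  is where \<open>h = 1\<close> enters the linearization.\<close>

lemma \<phi>_deriv:
  assumes "x \<in> strip"
  shows "(\<phi> has_real_derivative m x / (1 - a * x ^ 4)) (at x)"
proof -
  have w: "1 - a * x ^ 4 \<noteq> 0" using assms by (simp add: strip_def)
  have "(\<phi> has_real_derivative
      m x * b * x ^ 3 / (1 - a * x ^ 4) * (x + c * x ^ 5) + (1 + 5 * c * x ^ 4) * m x) (at x)"
    unfolding \<phi>_def[abs_def]
    by (rule DERIV_mult m_deriv assms)+ (auto intro!: derivative_eq_intros)
  moreover have "m x * b * x ^ 3 / (1 - a * x ^ 4) * (x + c * x ^ 5) + (1 + 5 * c * x ^ 4) * m x
      = m x * (b * x ^ 3 * (x + c * x ^ 5) + (1 + 5 * c * x ^ 4) * (1 - a * x ^ 4)) / (1 - a * x ^ 4)"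
    using w by (simp add: field_simps)
  moreover have "b * x ^ 3 * (x + c * x ^ 5) + (1 + 5 * c * x ^ 4) * (1 - a * x ^ 4) = 1"
  proof -
    have "b * x ^ 3 * (x + c * x ^ 5) + (1 + 5 * c * x ^ 4) * (1 - a * x ^ 4)
        = 1 + (5 * c - (a - b)) * x ^ 4 + c * (b - 5 * a) * x ^ 8" by algebra
    then show ?thesis using c_eq c_b by simp
  qed
  ultimately show ?thesis by simp
qed

lemma \<phi>_strict_mono:
  assumes "x \<in> strip" "z \<in> strip" "x < z"
  shows "\<phi> x < \<phi> z"
proof (rule DERIV_pos_imp_increasing[OF assms(3)])
  fix y assume "x \<le> y" "y \<le> z"
  then have y: "y \<in> strip" using strip_between assms by blast
  then have "m y / (1 - a * y ^ 4) > 0" using m_pos by (simp add: strip_def)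
  then show "\<exists>d. (\<phi> has_real_derivative d) (at y) \<and> d > 0" using \<phi>_deriv[OF y] by blast
qed

lemma \<phi>_eq_iff: "x \<in> strip \<Longrightarrow> z \<in> strip \<Longrightarrow> \<phi> x = \<phi> z \<longleftrightarrow> x = z"
  using \<phi>_strict_mono by (metis less_irrefl linorder_neqE)

lemma \<phi>_0: "\<phi> 0 = 0"
  by (simp add: \<phi>_def)

lemma \<phi>_minus: "\<phi> (- x) = - \<phi> x"
  by (simp add: \<phi>_def m_def algebra_simps)

lemma zero_in_strip: "0 \<in> strip"
  by (simp add: strip_def)

text \<open>Since \<open>x'\<close> contains the factor \<open>w = 1 - a x^4\<close>, this
  \<open>w\<close> satisfies the homogeneous linear equation \<open>w' = 4 a x^3 y w\<close> along a
  solution and keeps its sign.\<close>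

lemma strip_invariant:
  assumes sol: "solution_on X UNIV \<gamma>" and "fst (\<gamma> s) \<in> strip"
  shows "fst (\<gamma> t) \<in> strip"
proof -
  have "1 - a * fst (\<gamma> t) ^ 4 > 0"
  proof (rule linear_ode_pos[OF is_interval_univ UNIV_I UNIV_I, of "\<lambda>t. 1 - a * fst (\<gamma> t) ^ 4"
        "\<lambda>t. 4 * a * fst (\<gamma> t) ^ 3 * snd (\<gamma> t)" s])
    fix t
    have "((\<lambda>t. fst (\<gamma> t)) has_real_derivative - snd (\<gamma> t) + a * fst (\<gamma> t) ^ 4 * snd (\<gamma> t)) (at t)"
      using sol by (simp add: solution_on_quintic_iff)
    then have "((\<lambda>t. 1 - a * fst (\<gamma> t) ^ 4) has_real_derivative
        - (a * (4 * fst (\<gamma> t) ^ 3 * (- snd (\<gamma> t) + a * fst (\<gamma> t) ^ 4 * snd (\<gamma> t))))) (at t)"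
      by (auto intro!: derivative_eq_intros)
    moreover have "- (a * (4 * fst (\<gamma> t) ^ 3 * (- snd (\<gamma> t) + a * fst (\<gamma> t) ^ 4 * snd (\<gamma> t))))
        = 4 * a * fst (\<gamma> t) ^ 3 * snd (\<gamma> t) * (1 - a * fst (\<gamma> t) ^ 4)" by algebra
    ultimately show "((\<lambda>t. 1 - a * fst (\<gamma> t) ^ 4) has_real_derivative
        4 * a * fst (\<gamma> t) ^ 3 * snd (\<gamma> t) * (1 - a * fst (\<gamma> t) ^ 4)) (at t)" by (simp only:)
  qed (use assms solution_on_continuous[OF sol] in \<open>auto simp: strip_def intro!: continuous_intros\<close>)
  then show ?thesis by (simp add: strip_def)
qed

text \<open>The derivative of \<phi> cancels the factor \<open>1 - a x^4\<close> of
  \<open>x'\<close>, giving \<open>u' = - v\<close>; the derivative of \<open>m\<close> cancels the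
  term \<open>b x^3 y^2\<close> of \<open>y'\<close>, giving \<open>v' = u\<close>.\<close>

lemma solution_linearized:
  assumes sol: "solution_on X UNIV \<gamma>" and "fst (\<gamma> 0) \<in> strip"
  defines "u \<equiv> \<lambda>t. \<phi> (fst (\<gamma> t))" and "v \<equiv> \<lambda>t. m (fst (\<gamma> t)) * snd (\<gamma> t)"
  shows "u t = u 0 * cos t - v 0 * sin t" "v t = u 0 * sin t + v 0 * cos t"
proof -
  define x y where xy: "x = (\<lambda>t. fst (\<gamma> t))" "y = (\<lambda>t. snd (\<gamma> t))"
  have dx: "(x has_real_derivative - y s + a * x s ^ 4 * y s) (at s)"
    and dy: "(y has_real_derivative x s + b * x s ^ 3 * (y s)\<^sup>2 + c * x s ^ 5) (at s)" for s
    using sol unfolding solution_on_quintic_iff xy by auto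
  have xs: "x s \<in> strip" for s using strip_invariant[OF sol assms(2)] by (simp add: xy)
  then have w: "1 - a * x s ^ 4 \<noteq> 0" for s by (simp add: strip_def less_imp_neq[THEN not_sym])
  have dx': "- y s + a * x s ^ 4 * y s = - (y s * (1 - a * x s ^ 4))" for s by algebra
  have du: "(u has_real_derivative - v s) (at s)" for s
  proof -
    have "((\<lambda>s. \<phi> (x s)) has_real_derivative m (x s) / (1 - a * x s ^ 4) * - (y s * (1 - a * x s ^ 4))) (at s)"
      using DERIV_chain2[OF \<phi>_deriv[OF xs] dx] by (simp only: dx')
    then show ?thesis using w[of s] by (simp add: u_def v_def xy)
  qed
  have dv: "(v has_real_derivative u s) (at s)" for s
  proof -
    have "((\<lambda>s. m (x s)) has_real_derivative
        m (x s) * b * x s ^ 3 / (1 - a * x s ^ 4) * - (y s * (1 - a * x s ^ 4))) (at s)"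
      using DERIV_chain2[OF m_deriv[OF xs] dx] by (simp only: dx')
    then have "((\<lambda>s. m (x s)) has_real_derivative - (m (x s) * b * x s ^ 3 * y s)) (at s)"
      using w[of s] by (simp add: mult.assoc)
    then have "((\<lambda>s. m (x s) * y s) has_real_derivative
        - (m (x s) * b * x s ^ 3 * y s) * y s + (x s + b * x s ^ 3 * (y s)\<^sup>2 + c * x s ^ 5) * m (x s)) (at s)"
      by (rule DERIV_mult[OF _ dy])
    moreover have "- (m (x s) * b * x s ^ 3 * y s) * y s + (x s + b * x s ^ 3 * (y s)\<^sup>2 + c * x s ^ 5) * m (x s)
        = \<phi> (x s)" unfolding \<phi>_def by algebra
    ultimately show ?thesis by (simp add: u_def v_def xy)
  qed
  \<comment> \<open>\<open>A\<close> and \<open>B\<close> are the components of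
    \<open>(u, v)\<close> in a frame turning with angle \<open>t\<close>, hence constants of
    motion.\<close>
  have A: "u t * cos t + v t * sin t = u 0 * cos 0 + v 0 * sin 0"
    by (rule DERIV_isconst_all) (auto intro!: derivative_eq_intros du dv)
  have B: "v t * cos t - u t * sin t = v 0 * cos 0 - u 0 * sin 0"
    by (rule DERIV_isconst_all) (auto intro!: derivative_eq_intros du dv)
  have A: "u t * cos t + v t * sin t = u 0" and B: "v t * cos t - u t * sin t = v 0"
    using A B by simp_all
  have cs: "(sin t)\<^sup>2 + (cos t)\<^sup>2 = 1" by simp
  show "u t = u 0 * cos t - v 0 * sin t" unfolding A[symmetric] B[symmetric] using cs by algebra
  show "v t = u 0 * sin t + v 0 * cos t" unfolding A[symmetric] B[symmetric] using cs by algebra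
qed

lemma linearized_eq_zero_iff:
  assumes "fst q \<in> strip"
  shows "(\<phi> (fst q))\<^sup>2 + (m (fst q) * snd q)\<^sup>2 = 0 \<longleftrightarrow> q = (0, 0)"
proof -
  have "\<phi> (fst q) = 0 \<longleftrightarrow> fst q = 0"
    using \<phi>_eq_iff[OF assms zero_in_strip] by (simp add: \<phi>_0)
  then show ?thesis
    using m_pos[OF assms] by (cases q) (auto simp: sum_power2_eq_zero_iff)
qed

text \<open>The map to \<open>(u, v)\<close> is injective over the strip, so the period
  \<open>2 pi\<close> of the rotation transfers back. Conversely, a period \<open>T\<close> rotates
  a nonzero vector to itself, whence \<open>cos T = 1\<close>.\<close>

lemma period_function_eq_2pi:
  assumes sol: "solution_on X UNIV \<gamma>" "\<gamma> 0 = q" and q: "fst q \<in> strip" "q \<noteq> (0, 0)"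
  shows "period_function X q = 2 * pi"
  unfolding period_function_def
proof (rule Least_equality)
  have "\<gamma> (t + 2 * pi) = \<gamma> t" for t
  proof -
    have xs: "fst (\<gamma> s) \<in> strip" for s using strip_invariant[OF sol(1), of 0] sol(2) q by simp
    have eq: "\<phi> (fst (\<gamma> (t + 2 * pi))) = \<phi> (fst (\<gamma> t))"
      "m (fst (\<gamma> (t + 2 * pi))) * snd (\<gamma> (t + 2 * pi)) = m (fst (\<gamma> t)) * snd (\<gamma> t)"
      using solution_linearized[OF sol(1), of "t + 2 * pi"] solution_linearized[OF sol(1), of t] xs
      by simp_all
    then have "fst (\<gamma> (t + 2 * pi)) = fst (\<gamma> t)" using \<phi>_eq_iff xs by blast
    then show ?thesis using eq(2) m_pos[OF xs, of t] by (simp add: prod_eq_iff)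
  qed
  then show "\<exists>\<gamma>. solution_on X UNIV \<gamma> \<and> \<gamma> 0 = q \<and> periodic_with (2 * pi) \<gamma>"
    using sol by (auto simp: periodic_with_def)
next
  fix T assume "\<exists>\<gamma>. solution_on X UNIV \<gamma> \<and> \<gamma> 0 = q \<and> periodic_with T \<gamma>"
  then obtain \<delta> where \<delta>: "solution_on X UNIV \<delta>" "\<delta> 0 = q" "T > 0" "\<And>t. \<delta> (t + T) = \<delta> t"
    by (auto simp: periodic_with_def)
  define U V where UV: "U = \<phi> (fst q)" "V = m (fst q) * snd q"
  have "\<delta> T = q" using \<delta>(4)[of 0] \<delta>(2) by simp
  then have "U = U * cos T - V * sin T" "V = U * sin T + V * cos T"
    using solution_linearized[OF \<delta>(1), of T] \<delta>(2) q(1) by (simp_all add: UV)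
  \<comment> \<open>The first equation times \<open>U\<close> plus the second times
    \<open>V\<close>.\<close>
  then have "(U\<^sup>2 + V\<^sup>2) * (cos T - 1) = 0" by algebra
  moreover have "U\<^sup>2 + V\<^sup>2 \<noteq> 0" using linearized_eq_zero_iff[OF q(1)] q(2) by (simp add: UV)
  ultimately have "cos T - 1 = 0" by (metis mult_eq_0_iff)
  then have "cos T = 1" by simp
  then obtain n :: int where n: "T = n * 2 * pi" by (auto simp: cos_one_2pi_int)
  then have "n > 0" using \<delta>(3) by (simp add: zero_less_mult_iff)
  then have "1 * (2 * pi) \<le> real_of_int n * (2 * pi)" by (intro mult_right_mono) auto
  then show "2 * pi \<le> T" by (simp add: n)
qed

end

section \<open>Cycles around the origin lie over the strip\<close>

text \<open>The half-plane \<open>\<sigma> * fst z \<le> 0\<close> is convex and unbounded, contains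
  the origin and misses \<open>C\<close>; so the component of the origin in the complement of
  \<open>C\<close> is unbounded.\<close>

lemma not_inside_halfplane:
  fixes C :: "(real \<times> real) set"
  assumes "\<And>z. z \<in> C \<Longrightarrow> \<sigma> * fst z > 0"
  shows "(0, 0) \<notin> inside C"
proof
  assume "(0, 0) \<in> inside C"
  then have bdd: "bounded (connected_component_set (- C) (0, 0))" by (simp add: inside_def)
  have "convex {z. inner (\<sigma>, 0) z \<le> 0}" by (rule convex_halfspace_le)
  also have "{z. inner (\<sigma>, 0) z \<le> 0} = {z :: real \<times> real. \<sigma> * fst z \<le> 0}"
    by (auto simp: inner_prod_def)
  finally have "connected {z :: real \<times> real. \<sigma> * fst z \<le> 0}" by (rule convex_connected)
  then have "{z :: real \<times> real. \<sigma> * fst z \<le> 0} \<subseteq> connected_component_set (- C) (0, 0)"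
    by (rule connected_component_maximal[rotated]) (use assms in force)+
  then have "bounded {z :: real \<times> real. \<sigma> * fst z \<le> 0}" using bdd bounded_subset by blast
  then obtain B where B: "\<And>z :: real \<times> real. \<sigma> * fst z \<le> 0 \<Longrightarrow> norm z \<le> B"
    unfolding bounded_iff by blast
  have "norm (0 :: real, \<bar>B\<bar> + 1) \<le> B" by (rule B) simp
  then show False by (simp add: norm_Pair)
qed

context linearizable_quintic
begin

text \<open>By invariance an orbit that starts outside the strip stays outside. As 0 belongs to the
  strip, \<open>x\<close> never vanishes along it, so the orbit lies in an open half-plane bounded
  by the y-axis and cannot surround the origin.\<close>

lemma cycle_around_in_strip:
  assumes "cycle_around X (0, 0) (range \<gamma>)" "solution_on X UNIV \<gamma>"
  shows "fst (\<gamma> 0) \<in> strip"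
proof (rule ccontr)
  assume "fst (\<gamma> 0) \<notin> strip"
  then have out: "fst (\<gamma> t) \<notin> strip" for t using strip_invariant[OF assms(2)] by blast
  then have nz: "fst (\<gamma> t) \<noteq> 0" for t using zero_in_strip by metis
  have "connected ((\<lambda>t. fst (\<gamma> t)) ` UNIV)"
    using solution_on_continuous[OF assms(2)] by (intro connected_continuous_image continuous_intros) auto
  then have iv: "is_interval (range (\<lambda>t. fst (\<gamma> t)))" by (simp add: is_interval_connected_1)
  have "fst (\<gamma> 0) * fst (\<gamma> t) > 0" for t
  proof (rule ccontr)
    assume "\<not> ?thesis"
    then have "fst (\<gamma> 0) \<le> 0 \<and> 0 \<le> fst (\<gamma> t) \<or> fst (\<gamma> t) \<le> 0 \<and> 0 \<le> fst (\<gamma> 0)"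
      by (auto simp: zero_less_mult_iff not_less)
    then have "0 \<in> range (\<lambda>t. fst (\<gamma> t))"
      using iv unfolding is_interval_1 by (meson rangeI)
    then show False using nz by auto
  qed
  then have "(0, 0) \<notin> inside (range \<gamma>)"
    by (intro not_inside_halfplane[of _ "fst (\<gamma> 0)"]) auto
  then show False using assms(1) by (simp add: cycle_around_def)
qed

lemma period_function_const:
  assumes "cycle_around X (0, 0) (orbit X q)" "q \<noteq> (0, 0)"
  shows "period_function X q = 2 * pi"
proof -
  obtain \<gamma> where \<gamma>: "solution_on X UNIV \<gamma>" "\<gamma> 0 = q" "orbit X q = range \<gamma>"
    using cycle_orbit_solution assms(1) unfolding cycle_around_def by metis
  have "fst q \<in> strip" using cycle_around_in_strip[of \<gamma>] assms(1) \<gamma> by simp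
  then show ?thesis using period_function_eq_2pi \<gamma> assms(2) by blast
qed

end

section \<open>Explicit cycles near the origin, as preimages of circles\<close>

locale linearizable_quintic_box = linearizable_quintic +
  fixes l :: real
  assumes l_pos: "l > 0" and box_strip: "{-l..l} \<subseteq> strip"
begin

definition level :: "real \<Rightarrow> (real \<times> real) set" where
  "level \<rho> = {z. \<bar>fst z\<bar> < l \<and> (\<phi> (fst z))\<^sup>2 + (m (fst z) * snd z)\<^sup>2 = \<rho>\<^sup>2}"

definition \<psi> :: "real \<Rightarrow> real" where
  "\<psi> = inv_into {-l<..<l} \<phi>"

text \<open>The preimage of the uniform circular motion \<open>(\<rho> cos t, \<rho> sin t)\<close>
  under the linearizing coordinates.\<close>

definition cyc :: "real \<Rightarrow> real \<Rightarrow> real \<times> real" where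
  "cyc \<rho> t = (\<psi> (\<rho> * cos t), \<rho> * sin t / m (\<psi> (\<rho> * cos t)))"

lemma box: "\<bar>x\<bar> \<le> l \<Longrightarrow> x \<in> strip"
  using box_strip by (auto simp: abs_le_iff subset_iff)

lemma \<phi>_isCont: "\<bar>x\<bar> \<le> l \<Longrightarrow> isCont \<phi> x"
  using \<phi>_deriv box DERIV_isCont by blast

lemma \<psi>_\<phi>: "\<bar>x\<bar> < l \<Longrightarrow> \<psi> (\<phi> x) = x"
  unfolding \<psi>_def by (rule inv_into_f_f) (auto simp: inj_on_def \<phi>_eq_iff box abs_less_iff)

text \<open>\<phi> is odd, so its values at the ends of the box are \<open>- \<phi> l\<close> and
  \<open>\<phi> l\<close>, and the intermediate value theorem reaches everything strictly
  between.\<close>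

lemma \<psi>_props:
  assumes "\<bar>s\<bar> < \<phi> l"
  shows "\<phi> (\<psi> s) = s" "\<bar>\<psi> s\<bar> < l"
proof -
  have "\<exists>x\<ge>-l. x \<le> l \<and> \<phi> x = s"
    using assms l_pos by (intro IVT) (auto simp: \<phi>_minus intro!: \<phi>_isCont)
  then obtain x where x: "-l \<le> x" "x \<le> l" "\<phi> x = s" by blast
  moreover have "x \<noteq> l" "x \<noteq> -l" using x assms by (auto simp: \<phi>_minus)
  ultimately have "\<bar>x\<bar> < l" by auto
  then show "\<phi> (\<psi> s) = s" "\<bar>\<psi> s\<bar> < l" using \<psi>_\<phi>[of x] x(3) by auto
qed

lemma \<psi>_deriv:
  assumes s: "\<bar>s\<bar> < \<phi> l"
  shows "(\<psi> has_real_derivative (1 - a * \<psi> s ^ 4) / m (\<psi> s)) (at s)"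
proof -
  note p = \<psi>_props[OF s]
  have in_strip: "\<psi> s \<in> strip" using box p(2) by simp
  have "isCont \<psi> (\<phi> (\<psi> s))"
  \<comment> \<open>Half the distance from \<open>\<psi> s\<close> to the edge of the box, so that
    the closed neighbourhood stays in the open box.\<close>
  proof (rule isCont_inverse_function[where f = \<phi> and g = \<psi> and x = "\<psi> s" and d = "(l - \<bar>\<psi> s\<bar>) / 2"])
    show "0 < (l - \<bar>\<psi> s\<bar>) / 2" using p(2) by simp
    fix z assume "\<bar>z - \<psi> s\<bar> \<le> (l - \<bar>\<psi> s\<bar>) / 2"
    then have "\<bar>z\<bar> < l" using p(2) by (auto simp: abs_if field_simps split: if_splits)
    then show "\<psi> (\<phi> z) = z" "isCont \<phi> z" using \<psi>_\<phi> \<phi>_isCont by auto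
  qed
  then have "isCont \<psi> s" using p(1) by simp
  then have "(\<psi> has_real_derivative inverse (m (\<psi> s) / (1 - a * \<psi> s ^ 4))) (at s)"
    using s \<phi>_deriv[OF in_strip] m_pos[OF in_strip] in_strip
    by (intro DERIV_inverse_function[where f = \<phi> and g = \<psi> and x = s and a = "- \<phi> l" and b = "\<phi> l"])
       (auto simp: strip_def intro!: \<psi>_props)
  then show ?thesis by simp
qed

context
  fixes \<rho> :: real
  assumes \<rho>: "0 < \<rho>" "\<rho> < \<phi> l"
begin

lemma cos_range: "\<bar>\<rho> * cos t\<bar> < \<phi> l"
proof -
  have "\<bar>\<rho> * cos t\<bar> \<le> \<rho> * 1" unfolding abs_mult using \<rho> by (intro mult_mono) auto
  then show ?thesis using \<rho> by simp
qed

text \<open>The computation of \<open>solution_linearized\<close> run backwards. It exhibits global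
  solutions explicitly, so no existence theorem for differential equations is invoked.\<close>

lemma cyc_solution: "solution_on X UNIV (cyc \<rho>)"
  unfolding solution_on_quintic_iff
proof (intro ballI)
  fix t
  define x where "x = \<psi> (\<rho> * cos t)"
  define w M where wM: "w = 1 - a * x ^ 4" "M = m x"
  define y where "y = \<rho> * sin t / M"
  have xs: "x \<in> strip" using box \<psi>_props(2)[OF cos_range] by (simp add: x_def less_imp_le)
  have w: "w > 0" using xs by (simp add: strip_def wM)
  have M: "M > 0" using m_pos[OF xs] by (simp add: wM)
  have sin_eq: "\<rho> * sin t = M * y" using M by (simp add: y_def)
  have cos_eq: "\<rho> * cos t = M * (x + c * x ^ 5)"
    using \<psi>_props(1)[OF cos_range, of t] by (simp add: \<phi>_def x_def wM)
  have "((\<lambda>t. \<psi> (\<rho> * cos t)) has_real_derivative w / M * (\<rho> * - sin t)) (at t)"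
    unfolding wM x_def
    by (rule DERIV_chain2[where f = \<psi> and g = "\<lambda>t. \<rho> * cos t", OF \<psi>_deriv[OF cos_range]]) (auto intro!: derivative_eq_intros)
  moreover have "w / M * (\<rho> * - sin t) = - (w * y)"
    using M by (simp add: sin_eq)
  ultimately have dx: "((\<lambda>t. \<psi> (\<rho> * cos t)) has_real_derivative - (w * y)) (at t)" by simp
  have "((\<lambda>t. m (\<psi> (\<rho> * cos t))) has_real_derivative M * b * x ^ 3 / w * - (w * y)) (at t)"
    unfolding wM x_def by (rule DERIV_chain2[OF m_deriv dx[unfolded wM x_def]]) (use xs x_def in simp)
  then have dM: "((\<lambda>t. m (\<psi> (\<rho> * cos t))) has_real_derivative - (M * b * x ^ 3 * y)) (at t)"
    using w by (simp add: mult.assoc)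
  have "((\<lambda>t. \<rho> * sin t / m (\<psi> (\<rho> * cos t))) has_real_derivative
      (\<rho> * cos t * M - \<rho> * sin t * - (M * b * x ^ 3 * y)) / (M * M)) (at t)"
    unfolding wM x_def
    by (rule DERIV_divide[OF _ dM[unfolded wM x_def]])
       (use M in \<open>auto intro!: derivative_eq_intros simp: wM x_def\<close>)
  moreover have "(\<rho> * cos t * M - \<rho> * sin t * - (M * b * x ^ 3 * y)) / (M * M)
      = x + b * x ^ 3 * y\<^sup>2 + c * x ^ 5"
  proof -
    have "\<rho> * cos t * M - \<rho> * sin t * - (M * b * x ^ 3 * y) = (x + b * x ^ 3 * y\<^sup>2 + c * x ^ 5) * (M * M)"
      unfolding cos_eq sin_eq by algebra
    then show ?thesis using M by simp
  qed
  ultimately have dy: "((\<lambda>t. \<rho> * sin t / m (\<psi> (\<rho> * cos t))) has_real_derivative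
      x + b * x ^ 3 * y\<^sup>2 + c * x ^ 5) (at t)" by simp
  have "- (w * y) = - y + a * x ^ 4 * y" unfolding wM by algebra
  then show "((\<lambda>t. fst (cyc \<rho> t)) has_real_derivative
       - snd (cyc \<rho> t) + a * fst (cyc \<rho> t) ^ 4 * snd (cyc \<rho> t)) (at t)
     \<and> ((\<lambda>t. snd (cyc \<rho> t)) has_real_derivative
       fst (cyc \<rho> t) + b * fst (cyc \<rho> t) ^ 3 * (snd (cyc \<rho> t))\<^sup>2 + c * fst (cyc \<rho> t) ^ 5) (at t)"
    using dx dy by (simp add: cyc_def y_def wM x_def)
qed

lemma range_cyc: "range (cyc \<rho>) = level \<rho>"
proof (intro set_eqI iffI)
  fix z assume "z \<in> range (cyc \<rho>)"
  then obtain t where z: "z = cyc \<rho> t" by auto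
  note p = \<psi>_props[OF cos_range, of t]
  have "m (\<psi> (\<rho> * cos t)) > 0" using m_pos box p(2) by simp
  moreover have "(\<rho> * cos t)\<^sup>2 + (\<rho> * sin t)\<^sup>2 = \<rho>\<^sup>2"
    by (simp add: power_mult_distrib flip: distrib_left)
  ultimately show "z \<in> level \<rho>" using p by (simp add: z cyc_def level_def)
next
  fix z assume "z \<in> level \<rho>"
  then have z: "\<bar>fst z\<bar> < l" "(\<phi> (fst z))\<^sup>2 + (m (fst z) * snd z)\<^sup>2 = \<rho>\<^sup>2" by (auto simp: level_def)
  have "(\<phi> (fst z) / \<rho>)\<^sup>2 + (m (fst z) * snd z / \<rho>)\<^sup>2 = ((\<phi> (fst z))\<^sup>2 + (m (fst z) * snd z)\<^sup>2) / \<rho>\<^sup>2"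
    by (simp add: power_divide add_divide_distrib)
  also have "\<dots> = 1" using z(2) \<rho> by simp
  finally obtain t where t: "\<phi> (fst z) / \<rho> = cos t" "m (fst z) * snd z / \<rho> = sin t"
    by (rule sincos_total_2pi)
  then have t': "\<rho> * cos t = \<phi> (fst z)" "\<rho> * sin t = m (fst z) * snd z"
    using \<rho>(1) by (auto simp: field_simps)
  have "m (fst z) > 0" using m_pos box z(1) by simp
  then have "cyc \<rho> t = z" using z(1) by (simp add: cyc_def t' \<psi>_\<phi> prod_eq_iff)
  then show "z \<in> range (cyc \<rho>)" by blast
qed

text \<open>With \<open>N = u^2 + v^2\<close>, the open set \<open>W\<close> where
  \<open>N < \<rho>^2\<close> is the closed sublevel set \<open>D\<close> without the level curve.
  Hence \<open>W\<close> and the complement of \<open>D\<close> separate the complement of the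
  curve, and the component of the origin stays in \<open>W\<close>, which is bounded because
  \<open>1 / m\<close> is bounded on the compact box.\<close>

lemma zero_inside_level: "(0, 0) \<in> inside (level \<rho>)"
proof -
  define N where "N = (\<lambda>z :: real \<times> real. (\<phi> (fst z))\<^sup>2 + (m (fst z) * snd z)\<^sup>2)"
  define A where "A = {z :: real \<times> real. \<bar>fst z\<bar> \<le> l}"
  define A' where "A' = {z :: real \<times> real. \<bar>fst z\<bar> < l}"
  have mc: "continuous_on {-l..l} m"
    by (meson box_strip m_deriv DERIV_isCont continuous_at_imp_continuous_on subsetD)
  have \<phi>c: "continuous_on {-l..l} \<phi>"
    by (meson box_strip \<phi>_deriv DERIV_isCont continuous_at_imp_continuous_on subsetD)
  have "continuous_on A (\<lambda>z. m (fst z))" "continuous_on A (\<lambda>z. \<phi> (fst z))"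
    by (rule continuous_on_compose2[OF mc] continuous_on_compose2[OF \<phi>c];
        auto simp: A_def intro!: continuous_intros)+
  then have Nc: "continuous_on A N" unfolding N_def by (intro continuous_intros)
  have clA: "closed A" unfolding A_def by (intro closed_Collect_le continuous_intros)
  have opA: "open A'" unfolding A'_def by (intro open_Collect_less continuous_intros)
  define W where "W = {z \<in> A'. N z < \<rho>\<^sup>2}"
  define D where "D = {z \<in> A. N z \<le> \<rho>\<^sup>2}"
  have "closed (A \<inter> N -` {..\<rho>\<^sup>2})" using Nc clA by (intro continuous_closed_preimage) auto
  moreover have "A \<inter> N -` {..\<rho>\<^sup>2} = D" by (auto simp: D_def)
  ultimately have clD: "closed D" by simp
  have "A' \<subseteq> A" by (auto simp: A_def A'_def)
  then have "open (A' \<inter> N -` {..<\<rho>\<^sup>2})"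
    using continuous_on_subset[OF Nc] opA by (intro continuous_open_preimage) auto
  moreover have "A' \<inter> N -` {..<\<rho>\<^sup>2} = W" by (auto simp: W_def)
  ultimately have opW: "open W" by simp
  \<comment> \<open>On the edges of the box \<open>N\<close> is at least
    \<open>(\<phi> l)^2\<close>, which exceeds \<open>\<rho>^2\<close>; so \<open>D\<close> does not
    touch them, and the truncation to the box creates no further boundary.\<close>
  have DA': "z \<in> A'" if "z \<in> D" for z
  proof -
    have "(\<phi> (fst z))\<^sup>2 \<le> \<rho>\<^sup>2" using that by (simp add: D_def N_def) (smt (verit) zero_le_power2)
    then have "\<bar>\<phi> (fst z)\<bar> \<le> \<rho>" using \<rho>(1) by (metis abs_le_square_iff abs_of_pos)
    then have "fst z \<noteq> l" "fst z \<noteq> - l" using \<rho> by (auto simp: \<phi>_minus)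
    then show ?thesis using that by (auto simp: D_def A_def A'_def)
  qed
  have zW: "(0, 0) \<in> W" using l_pos \<rho> by (simp add: W_def A'_def N_def \<phi>_0)
  have "level \<rho> = {z \<in> A'. N z = \<rho>\<^sup>2}" by (simp add: level_def A'_def N_def)
  then have cover: "- level \<rho> \<subseteq> W \<union> - D" "W \<inter> level \<rho> = {}"
    using DA' by (auto simp: W_def D_def)
  have WD: "W \<subseteq> D" using \<open>A' \<subseteq> A\<close> by (auto simp: W_def D_def)
  define K where "K = connected_component_set (- level \<rho>) (0, 0)"
  have "connected K" "K \<subseteq> - level \<rho>" by (simp_all add: K_def connected_component_subset)
  have zK: "(0, 0) \<in> K" using zW cover(2) by (auto simp: K_def connected_component_refl_eq)
  have "K \<subseteq> W"
  proof -
    have "W \<inter> K = {} \<or> - D \<inter> K = {}"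
      using \<open>connected K\<close> opW clD cover(1) \<open>K \<subseteq> - level \<rho>\<close> WD
      by (intro connectedD) auto
    then have "- D \<inter> K = {}" using zW zK by blast
    then show ?thesis using cover(1) \<open>K \<subseteq> - level \<rho>\<close> by blast
  qed
  moreover have "bounded W"
  proof -
    have "continuous_on {-l..l} (\<lambda>x. 1 / m x)"
      using m_pos box_strip by (intro continuous_intros mc) force
    then have "bounded ((\<lambda>x. 1 / m x) ` {-l..l})"
      by (intro compact_imp_bounded compact_continuous_image) auto
    then obtain B where B: "\<And>x. x \<in> {-l..l} \<Longrightarrow> \<bar>1 / m x\<bar> \<le> B"
      unfolding bounded_iff real_norm_def by blast
    have "norm z \<le> l + \<rho> * B" if "z \<in> W" for z
    proof -
      have x: "\<bar>fst z\<bar> < l" using that by (simp add: W_def A'_def)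
      then have m: "m (fst z) > 0" using m_pos box by simp
      have "(m (fst z) * snd z)\<^sup>2 \<le> \<rho>\<^sup>2" using that by (simp add: W_def N_def) (smt (verit) zero_le_power2)
      then have "\<bar>m (fst z) * snd z\<bar> \<le> \<rho>" using \<rho>(1) by (metis abs_le_square_iff abs_of_pos)
      then have "\<bar>snd z\<bar> \<le> \<rho> * (1 / m (fst z))" using m by (simp add: abs_mult field_simps)
      also have "\<dots> \<le> \<rho> * B" using B[of "fst z"] x m \<rho> by (intro mult_left_mono) (auto simp: abs_less_iff)
      finally show ?thesis using norm_Pair_le[of "fst z" "snd z"] x by simp
    qed
    then show ?thesis unfolding bounded_iff by blast
  qed
  ultimately have "bounded K" using bounded_subset by blast
  then show ?thesis using zW cover(2) by (auto simp: inside_def K_def)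
qed

lemma level_cycle_around:
  assumes "q \<in> level \<rho>"
  shows "cycle_around X (0, 0) (orbit X q)"
proof -
  obtain s where "q = cyc \<rho> s" using assms range_cyc by auto
  then have orb: "orbit X q = range (cyc \<rho>)" using quintic_orbit_eq_range[OF cyc_solution] by simp
  have "periodic_with (2 * pi) (cyc \<rho>)" by (simp add: periodic_with_def cyc_def)
  moreover have "\<not> cyc \<rho> constant_on UNIV"
  proof
    assume "cyc \<rho> constant_on UNIV"
    then have "cyc \<rho> 0 = cyc \<rho> pi" by (auto simp: constant_on_def)
    then have "\<psi> \<rho> = \<psi> (- \<rho>)" by (simp add: cyc_def)
    then have "\<rho> = - \<rho>" using \<psi>_props(1)[of \<rho>] \<psi>_props(1)[of "- \<rho>"] \<rho> by simp
    then show False using \<rho> by simp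
  qed
  ultimately have "is_cycle X (range (cyc \<rho>))" unfolding is_cycle_def using cyc_solution by blast
  then show ?thesis using zero_inside_level by (simp add: cycle_around_def orb range_cyc)
qed

end

text \<open>A point \<open>z\<close> near the origin lies on the level of radius
  \<open>sqrt (N z)\<close>, which continuity of \<open>N\<close> puts below
  \<open>\<phi> l\<close>; this gives the center. The period is then settled on the entire annulus,
  also beyond the box, by \<open>period_function_const\<close>.\<close>

lemma isochronous: "isochronous_center X (0, 0)"
proof -
  define N where "N = (\<lambda>z :: real \<times> real. (\<phi> (fst z))\<^sup>2 + (m (fst z) * snd z)\<^sup>2)"
  have \<phi>l: "\<phi> l > 0" using \<phi>_strict_mono[of 0 l] box l_pos by (simp add: \<phi>_0 zero_in_strip)
  have lim: "((\<lambda>z. fst z) \<longlongrightarrow> 0) (at (0 :: real \<times> real))" "((\<lambda>z. snd z) \<longlongrightarrow> 0) (at (0 :: real \<times> real))"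
    by (rule tendsto_eq_intros | simp)+
  have "isCont m 0" using m_deriv zero_in_strip DERIV_isCont by blast
  then have "((\<lambda>z. m (fst z)) \<longlongrightarrow> m 0) (at (0 :: real \<times> real))"
    using lim(1) isCont_tendsto_compose by blast
  moreover have "((\<lambda>z. \<phi> (fst z)) \<longlongrightarrow> \<phi> 0) (at (0 :: real \<times> real))"
    using lim(1) isCont_tendsto_compose[OF \<phi>_isCont[of 0]] l_pos by simp
  ultimately have "(N \<longlongrightarrow> (\<phi> 0)\<^sup>2 + (m 0 * 0)\<^sup>2) (at 0)"
    unfolding N_def by (intro tendsto_intros lim)
  then have "(N \<longlongrightarrow> 0) (at 0)" by (simp add: \<phi>_0)
  then have ev1: "\<forall>\<^sub>F z in at 0. N z < (\<phi> l)\<^sup>2" using \<phi>l by (intro order_tendstoD) auto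
  have "((\<lambda>z. \<bar>fst z\<bar>) \<longlongrightarrow> \<bar>0\<bar>) (at (0 :: real \<times> real))" by (intro tendsto_intros lim)
  then have ev2: "\<forall>\<^sub>F z in at (0 :: real \<times> real). \<bar>fst z\<bar> < l" using l_pos by (intro order_tendstoD) auto
  \<comment> \<open>For isolation of the singular point: over the strip a zero of the field has
    \<open>y = 0\<close>, where the second component is \<open>x (1 + c x^4)\<close>. Positivity of
    this factor leaves only the origin.\<close>
  have "((\<lambda>z. 1 + c * fst z ^ 4) \<longlongrightarrow> 1 + c * 0 ^ 4) (at (0 :: real \<times> real))" by (intro tendsto_intros lim)
  then have ev3: "\<forall>\<^sub>F z in at (0 :: real \<times> real). 1 + c * fst z ^ 4 > 0" by (intro order_tendstoD) auto
  have ev0: "\<forall>\<^sub>F z in at (0 :: real \<times> real). z \<noteq> 0" by (simp add: eventually_at_filter)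
  have "\<forall>\<^sub>F z in at 0. cycle_around X (0, 0) (orbit X z)"
    using ev0 ev1 ev2
  proof eventually_elim
    case (elim z)
    have "fst z \<in> strip" using box elim by simp
    then have "N z \<noteq> 0" using linearized_eq_zero_iff elim by (simp add: N_def zero_prod_def)
    moreover have "N z \<ge> 0" by (simp add: N_def)
    ultimately have "N z > 0" by simp
    moreover have "sqrt (N z) < \<phi> l" using elim \<phi>l by (intro real_less_lsqrt) (auto simp: N_def)
    moreover have "z \<in> level (sqrt (N z))" using elim \<open>N z > 0\<close> by (simp add: level_def N_def)
    ultimately show ?case by (intro level_cycle_around[of "sqrt (N z)"]) auto
  qed
  moreover have "\<forall>\<^sub>F z in at 0. X z \<noteq> 0"
    using ev0 ev2 ev3
  proof eventually_elim
    case (elim z)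
    obtain x y where z: "z = (x, y)" by force
    have w: "1 - a * x ^ 4 > 0" using box[of x] elim by (simp add: z strip_def)
    show ?case
    proof
      assume "X z = 0"
      then have 1: "- y + a * x ^ 4 * y = 0" and 2: "x + b * x ^ 3 * y\<^sup>2 + c * x ^ 5 = 0"
        by (auto simp: quintic_field_def z zero_prod_def)
      have "y * (1 - a * x ^ 4) = 0" using 1 by algebra
      then have "y = 0" using w by simp
      moreover from this have "x * (1 + c * x ^ 4) = 0" using 2 by algebra
      then have "x = 0" using elim by (auto simp: z)
      ultimately show False using elim by (simp add: z zero_prod_def)
    qed
  qed
  moreover have "X (0, 0) = 0" by (simp add: quintic_field_def zero_prod_def)
  ultimately have cen: "is_center X (0, 0)"
    unfolding is_center_def isolated_singular_point_def by (simp add: zero_prod_def)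
  have "period_function X q = 2 * pi" if "q \<in> period_annulus X (0, 0) - {(0, 0)}" for q
    using period_annulus_greatest(1)[OF cen] that period_function_const
    unfolding cycle_covered_nbhd_def by blast
  then show ?thesis unfolding isochronous_center_def using cen by blast
qed

end

lemma (in linearizable_quintic) isochronous_center: "isochronous_center X (0, 0)"
proof -
  have "((\<lambda>x. 1 - a * x ^ 4) \<longlongrightarrow> 1 - a * 0 ^ 4) (nhds 0)"
    by (intro tendsto_intros filterlim_ident)
  then have "\<forall>\<^sub>F x in nhds 0. 1 - a * x ^ 4 > 0" by (intro order_tendstoD) auto
  then obtain d where d: "d > 0" "\<And>x. \<bar>x\<bar> < d \<Longrightarrow> 1 - a * x ^ 4 > 0"
    by (auto simp: eventually_nhds_metric)
  interpret linearizable_quintic_box a b c \<kappa> "d / 2"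
    using d by unfold_locales (auto simp: strip_def)
  show ?thesis by (rule isochronous)
qed

theorem theorem8:
  fixes a b c :: real
  shows "isochronous_center (quintic_field a b c) (0, 0) \<longleftrightarrow>
           (b = 5 * a \<and> c = - (4 / 5) * a) \<or> (b = a \<and> c = 0)"
proof
  assume "isochronous_center (quintic_field a b c) (0, 0)"
  then have "5 * c - a + b = 0" "c = 0 \<or> b = 5 * a"
    using quintic_isochronous_imp by (simp, fastforce)
  then show "(b = 5 * a \<and> c = - (4 / 5) * a) \<or> (b = a \<and> c = 0)" by auto
next
  assume "(b = 5 * a \<and> c = - (4 / 5) * a) \<or> (b = a \<and> c = 0)"
  then show "isochronous_center (quintic_field a b c) (0, 0)"
  proof
    assume "b = 5 * a \<and> c = - (4 / 5) * a"
    then interpret linearizable_quintic a b c "5 / 4" by unfold_locales auto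
    show ?thesis by (rule isochronous_center)
  next
    assume "b = a \<and> c = 0"
    then interpret linearizable_quintic a b c "1 / 4" by unfold_locales auto
    show ?thesis by (rule isochronous_center)
  qed
qed

end
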